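(* Suppose $\mathbb{P}^*$ has independent components, with $\mathrm{supp}(\mathbb{P}^* )\subseteq[\hat{\mathbf{u}}^{(0)},\hat{\mathbf{u}}^{(N+1)}]$. With probability at least $1-\alpha$ with respect to the sampling, $\{\mathcal{U}^I_\epsilon:0<\epsilon<1\}$ simultaneously implies a probabilistic guarantee for $\mathbb{P}^*$, where $$\mathcal{U}^I_\epsilon=\Big\{\mathbf{u}\in\mathbb{R}^d:\ \exists\,\theta_i\in[0,1],\ \mathbf{q}^i\in\Delta_{N+2},\ i=1,\dots,d:\ \sum_{j=0}^{N+1}\hat u_i^{(j)}q^i_j=u_i\ (i=1,\dots,d),\ \ \sum_{i=1}^dD\big(\mathbf{q}^i,\theta_i\mathbf{q}^L(\Gamma^{KS})+(1-\theta_i)\mathbf{q}^R(\Gamma^{KS})\big)\le\log(1/\epsilon)\Big\}.$$ Moreover, $$\delta^*(\mathbf{v}\mid\mathcal{U}^I_\epsilon)=\inf_{\lambda\ge0}\Big\{\lambda\log(1/\epsilon)+\lambda\sum_{i=1}^d\log\Big[\max\Big(\sum_{j=0}^{N+1}q^L_j(\Gamma^{KS})e^{v_i\hat u_i^{(j)}/\lambda},\ \sum_{j=0}^{N+1}q^R_j(\Gamma^{KS})e^{v_i\hat u_i^{(j)}/\lambda}\Big)\Big]\Big\}.$$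
   Context: $0<\alpha<1$; $\mathcal{S}=\{\hat{\mathbf{u}}^1,\dots,\hat{\mathbf{u}}^N\}$ is drawn i.i.d. from the unknown measure $\mathbb{P}^*$ on $\mathbb{R}^d$ with marginals $\mathbb{P}^*_i$; $\tilde{\mathbf{u}}$ is a random vector. $[\hat{\mathbf{u}}^{(0)},\hat{\mathbf{u}}^{(N+1)}]=\{\mathbf{u}:\hat u_i^{(0)}\le u_i\le\hat u_i^{(N+1)},\ i=1,\dots,d\}$ is a known finite box. For $1\le j\le N$, $\hat u_i^{(j)}$ is the $j$-th order statistic (in increasing order) of $\hat u_i^1,\dots,\hat u_i^N$. $\Gamma^{KS}\in[0,1]$ is the threshold of the Kolmogorov–Smirnov test at level $\alpha'=1-\sqrt[d]{1-\alpha}$ with $N$ samples: the test of $H_0:\mathbb{P}_i^*=\mathbb{P}_{0,i}$ rejects if $\max_{j=1,\dots,N}\max\big(\frac jN-\mathbb{P}_{0,i}(\tilde u_i\le\hat u_i^{(j)}),\ \mathbb{P}_{0,i}(\tilde u_i<\hat u_i^{(j)})-\frac{j-1}N\big)>\Gamma^{KS}$, and incorrectly rejects with probability at most $\alpha'$. $\Delta_{N+2}$ is the probability simplex of vectors indexed by $0,\dots,N+1$. For $\Gamma\in[0,1]$, $q^L_0(\Gamma)=\Gamma$; $q^L_j(\Gamma)=\frac1N$ for $1\le j\le\lfloor N(1-\Gamma)\rfloor$; $q^L_j(\Gamma)=1-\Gamma-\frac{\lfloor N(1-\Gamma)\rfloor}N$ for $j=\lfloor N(1-\Gamma)\rfloor+1$;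 $q^L_j(\Gamma)=0$ otherwise; and $q^R_j(\Gamma)=q^L_{N+1-j}(\Gamma)$ for $j=0,\dots,N+1$. $D(\mathbf{p},\mathbf{q})=\sum_jp_j\log(p_j/q_j)$ is relative entropy (with $0\log(0/q)=0$ and $p\log(p/0)=+\infty$ for $p>0$). The expression in the infimum at $\lambda=0$ is understood as its limit as $\lambda\downarrow0$. $\delta^*(\mathbf{v}\mid\mathcal{U})=\sup_{\mathbf{u}\in\mathcal{U}}\mathbf{v}^T\mathbf{u}$. A set $\mathcal{U}$ implies a probabilistic guarantee for $\mathbb{P}^*$ at level $\epsilon$ if for every $\mathbf{x}^*\in\mathbb{R}^k$ and every real-valued $f(\mathbf{u},\mathbf{x})$ concave in $\mathbf{u}$ for all $\mathbf{x}$: $f(\mathbf{u},\mathbf{x}^* )\le0\ \forall\mathbf{u}\in\mathcal{U}$ implies $\mathbb{P}^*(f(\tilde{\mathbf{u}},\mathbf{x}^* )\le0)\ge1-\epsilon$. A family $\{\mathcal{U}_\epsilon:0<\epsilon<1\}$ simultaneously implies a probabilistic guarantee for $\mathbb{P}^*$ if for every $0<\epsilon<1$ the set $\mathcal{U}_\epsilon$ implies one at level $\epsilon$. *)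

theory Defs
  imports "HOL-Probability.Probability"
begin

text \<open>The smallest closed set of full measure.\<close>
definition measure_support :: "'a::topological_space measure \<Rightarrow> 'a set" where
  "measure_support P = \<Inter>{C. closed C \<and> measure P C = 1}"

text \<open>Samples and order statistics are numbered from 1; only \<open>x 1, \<dots>, x N\<close> matter,
  and \<open>order_stat N x j\<close> is meaningful for \<open>1 \<le> j \<le> N\<close>.\<close>
definition order_stat :: "nat \<Rightarrow> (nat \<Rightarrow> real) \<Rightarrow> nat \<Rightarrow> real" where
  "order_stat N x j = sort (map x [1..<N + 1]) ! (j - 1)"

text \<open>The order statistics, extended at indices \<open>0\<close> and \<open>N + 1\<close> by the end points of the
  known support interval.\<close>
definition ext_order_stat :: "nat \<Rightarrow> real \<Rightarrow> real \<Rightarrow> (nat \<Rightarrow> real) \<Rightarrow> nat \<Rightarrow> real" where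
  "ext_order_stat N lo hi x j =
     (if j = 0 then lo else if j = N + 1 then hi else order_stat N x j)"

definition ks_stat :: "nat \<Rightarrow> real measure \<Rightarrow> (nat \<Rightarrow> real) \<Rightarrow> real" where
  "ks_stat N P0 x = Max ((\<lambda>j.
     max (real j / real N - measure P0 {..order_stat N x j})
         (measure P0 {..<order_stat N x j} - (real j - 1) / real N)) ` {1..N})"

text \<open>\<open>\<Gamma>\<close> is a valid threshold for the Kolmogorov--Smirnov test with \<open>N\<close> samples at level \<open>a\<close>:
  whatever the hypothesized distribution \<open>P0\<close>, if it is the true one then the test rejects it
  with probability at most \<open>a\<close>.\<close>
definition ks_threshold :: "nat \<Rightarrow> real \<Rightarrow> real \<Rightarrow> bool" where
  "ks_threshold N a \<Gamma> \<longleftrightarrow> 0 \<le> \<Gamma> \<and> \<Gamma> \<le> 1 \<and>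
     (\<forall>P0 :: real measure. prob_space P0 \<and> sets P0 = sets borel \<longrightarrow>
        measure (Pi\<^sub>M {1..N} (\<lambda>_. P0))
          {x \<in> space (Pi\<^sub>M {1..N} (\<lambda>_. P0)). ks_stat N P0 x > \<Gamma>} \<le> a)"

text \<open>Vectors indexed by \<open>0, \<dots>, N + 1\<close> are functions on \<^typ>\<open>nat\<close> whose values
  beyond \<open>N + 1\<close> are ignored.\<close>
definition prob_simplex :: "nat \<Rightarrow> (nat \<Rightarrow> real) set" where
  "prob_simplex N = {p. (\<forall>j\<in>{0..N + 1}. 0 \<le> p j) \<and> (\<Sum>j = 0..N + 1. p j) = 1}"

definition qL :: "nat \<Rightarrow> real \<Rightarrow> nat \<Rightarrow> real" where
  "qL N \<Gamma> j =
     (let m = nat \<lfloor>real N * (1 - \<Gamma>)\<rfloor> in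
      if j = 0 then \<Gamma>
      else if j \<le> m then 1 / real N
      else if j = m + 1 then 1 - \<Gamma> - real m / real N
      else 0)"

definition qR :: "nat \<Rightarrow> real \<Rightarrow> nat \<Rightarrow> real" where
  "qR N \<Gamma> j = qL N \<Gamma> (N + 1 - j)"

definition rel_entropy_term :: "real \<Rightarrow> real \<Rightarrow> ereal" where
  "rel_entropy_term p q =
     (if p = 0 then 0 else if q = 0 then \<infinity> else ereal (p * ln (p / q)))"

definition rel_entropy :: "nat \<Rightarrow> (nat \<Rightarrow> real) \<Rightarrow> (nat \<Rightarrow> real) \<Rightarrow> ereal" where
  "rel_entropy N p q = (\<Sum>j = 0..N + 1. rel_entropy_term (p j) (q j))"

text \<open>In the following, \<open>h i j\<close> stands for the extended order statistic of index \<open>j\<close> in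
  coordinate \<open>i\<close>.\<close>
definition U_indep :: "nat \<Rightarrow> real \<Rightarrow> ('d \<Rightarrow> nat \<Rightarrow> real) \<Rightarrow> real \<Rightarrow> (real ^ 'd::finite) set" where
  "U_indep N \<Gamma> h \<epsilon> = {u. \<exists>(\<theta> :: 'd \<Rightarrow> real) (q :: 'd \<Rightarrow> nat \<Rightarrow> real).
     (\<forall>i. 0 \<le> \<theta> i \<and> \<theta> i \<le> 1) \<and>
     (\<forall>i. q i \<in> prob_simplex N) \<and>
     (\<forall>i. (\<Sum>j = 0..N + 1. h i j * q i j) = u $ i) \<and>
     (\<Sum>i\<in>UNIV. rel_entropy N (q i) (\<lambda>j. \<theta> i * qL N \<Gamma> j + (1 - \<theta> i) * qR N \<Gamma> j))
       \<le> ereal (ln (1 / \<epsilon>))}"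

text \<open>Suprema and infima are taken in \<^typ>\<open>ereal\<close>, where they have their usual meaning also for
  empty or unbounded sets.\<close>
definition support_fun :: "real ^ 'd::finite \<Rightarrow> (real ^ 'd) set \<Rightarrow> ereal" where
  "support_fun v U = (SUP u\<in>U. ereal (v \<bullet> u))"

definition dual_expr ::
  "nat \<Rightarrow> real \<Rightarrow> ('d::finite \<Rightarrow> nat \<Rightarrow> real) \<Rightarrow> real \<Rightarrow> real ^ 'd \<Rightarrow> real \<Rightarrow> real" where
  "dual_expr N \<Gamma> h \<epsilon> v \<mu> = \<mu> * ln (1 / \<epsilon>) + \<mu> * (\<Sum>i\<in>UNIV. ln (max
     (\<Sum>j = 0..N + 1. qL N \<Gamma> j * exp (v $ i * h i j / \<mu>))
     (\<Sum>j = 0..N + 1. qR N \<Gamma> j * exp (v $ i * h i j / \<mu>))))"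

definition dual_objective ::
  "nat \<Rightarrow> real \<Rightarrow> ('d::finite \<Rightarrow> nat \<Rightarrow> real) \<Rightarrow> real \<Rightarrow> real ^ 'd \<Rightarrow> real \<Rightarrow> real" where
  "dual_objective N \<Gamma> h \<epsilon> v \<mu> =
     (if \<mu> = 0 then Lim (at_right 0) (dual_expr N \<Gamma> h \<epsilon> v) else dual_expr N \<Gamma> h \<epsilon> v \<mu>)"

text \<open>The type argument \<open>'k\<close> gives the dimension of the decision variable. The event below is
  measurable, since a finite concave function on the whole space is continuous.\<close>
definition implies_guarantee ::
  "'k::finite itself \<Rightarrow> (real ^ 'd::finite) measure \<Rightarrow> real \<Rightarrow> (real ^ 'd) set \<Rightarrow> bool" where
  "implies_guarantee _ P \<epsilon> U \<longleftrightarrow>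
     (\<forall>(x' :: real ^ 'k) (f :: real ^ 'd \<Rightarrow> real ^ 'k \<Rightarrow> real).
        (\<forall>x. concave_on UNIV (\<lambda>u. f u x)) \<longrightarrow>
        (\<forall>u\<in>U. f u x' \<le> 0) \<longrightarrow>
        measure P {u \<in> space P. f u x' \<le> 0} \<ge> 1 - \<epsilon>)"

definition simultaneously_implies_guarantee ::
  "'k::finite itself \<Rightarrow> (real ^ 'd::finite) measure \<Rightarrow> (real \<Rightarrow> (real ^ 'd) set) \<Rightarrow> bool" where
  "simultaneously_implies_guarantee k P U \<longleftrightarrow>
     (\<forall>\<epsilon>. 0 < \<epsilon> \<and> \<epsilon> < 1 \<longrightarrow> implies_guarantee k P \<epsilon> (U \<epsilon>))"

end

theory Submission
  imports Defs
begin

text \<open>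
  Fix a direction \<open>v\<close>. The dual expression at a multiplier \<open>\<mu> > 0\<close> is a Chernoff bound in disguise: if
  every coordinate of a random vector \<open>u\<close> satisfies
  \<open>E exp (c u\<^sub>i) \<le> max (\<Sum>\<^sub>j q\<^sup>L\<^sub>j exp (c h\<^sub>i\<^sub>j)) (\<Sum>\<^sub>j q\<^sup>R\<^sub>j exp (c h\<^sub>i\<^sub>j))\<close> for all \<open>c\<close>, then independence of the
  coordinates and Markov's inequality for \<open>exp (v \<bullet> u / \<mu>)\<close> give
  \<open>Prob (v \<bullet> u \<ge> s) \<le> \<epsilon> exp ((dual_expr \<mu> - s) / \<mu>)\<close>, so that \<open>v \<bullet> u\<close> exceeds the infimum of the dual
  expressions with probability at most \<open>\<epsilon>\<close>. Three things remain.

  \<^item> The infimum is the support function of the uncertainty set (\<open>support_fun_U_indep\<close>). Relative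
    entropy and the logarithm of an exponential moment are conjugate to each other (Gibbs' inequality),
    so the dual expression is the Lagrangian of the entropy constraint, maximized over \<open>\<theta>\<close> and \<open>q\<close>; an
    exponential moment is linear in \<open>\<theta>\<close>, whence the maximum of the two extreme cases. There is no
    duality gap because relative entropy is jointly convex and the constraint is strictly feasible
    (\<open>q = \<theta> q\<^sup>L + (1 - \<theta>) q\<^sup>R\<close> has entropy \<open>0 < ln (1 / \<epsilon>)\<close>): a line separates the attainable pairs
    (objective, entropy) from the pairs that are better than optimal.

  \<^item> The moment bound holds when the Kolmogorov--Smirnov test accepts the true marginal
    (\<open>mgf_dominated_if_ks_accepts\<close>). Acceptance bounds the distribution function at each order
    statistic from both sides by \<open>\<Gamma>\<close>, and \<open>q\<^sup>R\<close> and \<open>q\<^sup>L\<close> are the stochastically largest and smallest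
    distributions on the order statistics and the end points of the box that these bounds permit. An increasing function
    \<open>exp (c u)\<close>, \<open>c \<ge> 0\<close>, therefore has its largest expectation under \<open>q\<^sup>R\<close>, a decreasing one under
    \<open>q\<^sup>L\<close>.

  \<^item> All \<open>d\<close> tests accept with probability at least \<open>1 - \<alpha>\<close> (\<open>prob_all_ks_accept\<close>). The samples of
    different coordinates are independent, so the acceptance probabilities multiply, and each of
    them is at least the \<open>d\<close>-th root of \<open>1 - \<alpha>\<close>.

  Finally, if a concave \<open>f\<close> is nonpositive on the uncertainty set, then \<open>{u. f u > 0}\<close> is an open
  convex set disjoint from that convex set. A hyperplane separates them, and the set where \<open>f\<close> is
  positive lies in a half-space \<open>v \<bullet> u > s\<close> of probability at most \<open>\<epsilon>\<close>
  (\<open>U_indep_implies_guarantee\<close>). The event on which the moment bound holds does not depend on \<open>\<epsilon>\<close> or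
  \<open>f\<close>; this makes the guarantee simultaneous.
\<close>

section \<open>Relative entropy on a finite index set\<close>

text \<open>The function \<open>(p, q) \<mapsto> p ln (p / q)\<close> is homogeneous of degree one and convex; the left-hand side is its
tangent along the ray \<open>p = c q\<close>. Convexity of relative entropy and Gibbs' inequality both come from
choosing \<open>c\<close>.\<close>
lemma rel_entropy_term_tangent:
  fixes p q c :: real
  assumes "0 \<le> p" "0 \<le> q" "q = 0 \<Longrightarrow> p = 0" "0 < c"
  shows "p * ln c + p - c * q \<le> p * ln (p / q)"
proof (cases "p = 0")
  case True
  then show ?thesis using assms by simp
next
  case False
  then have p: "0 < p" and q: "0 < q" using assms by force+
  have "ln (c * q / p) \<le> c * q / p - 1"
    using p q assms(4) by (intro ln_le_minus_one) simp
  moreover have "ln (c * q / p) = ln c - ln (p / q)"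
    using p q assms(4) by (simp add: ln_mult ln_div)
  ultimately have "p * (ln c - ln (p / q)) \<le> p * (c * q / p - 1)"
    using p by (intro mult_left_mono) auto
  then show ?thesis using p by (simp add: algebra_simps)
qed

text \<open>Add up the two tangents with the common slope \<open>c = (p + p') / (q + q')\<close>, for which the linear terms
cancel.\<close>
lemma log_sum_inequality_two:
  fixes p q p' q' :: real
  assumes "0 \<le> p" "0 \<le> q" "q = 0 \<Longrightarrow> p = 0" "0 \<le> p'" "0 \<le> q'" "q' = 0 \<Longrightarrow> p' = 0"
  shows "(p + p') * ln ((p + p') / (q + q')) \<le> p * ln (p / q) + p' * ln (p' / q')"
proof (cases "p + p' = 0")
  case True
  then have "p = 0" "p' = 0" using assms by linarith+
  then show ?thesis by simp
next
  case False
  define c where "c = (p + p') / (q + q')"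
  have "0 < p + p'" using False assms by linarith
  moreover have q: "0 < q + q'" using False assms by fastforce
  ultimately have c: "0 < c" by (simp add: c_def)
  have "p * ln c + p - c * q + (p' * ln c + p' - c * q') \<le> p * ln (p / q) + p' * ln (p' / q')"
    by (intro add_mono rel_entropy_term_tangent assms c)
  moreover have "c * q + c * q' = p + p'"
    using q unfolding distrib_left[symmetric] by (simp add: c_def)
  ultimately show ?thesis
    unfolding c_def[symmetric] by (simp add: algebra_simps)
qed

text \<open>The extended-real relative entropy is infinite unless \<open>q j = 0\<close> forces \<open>p j = 0\<close>. Splitting it into this
condition and a real-valued sum, in which the conventions \<open>x / 0 = 0\<close> and \<open>ln 0 = 0\<close> make the null terms
vanish, lets all estimates take place in the reals.\<close>
definition abs_cont :: "nat \<Rightarrow> (nat \<Rightarrow> real) \<Rightarrow> (nat \<Rightarrow> real) \<Rightarrow> bool" where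
  "abs_cont N p q \<longleftrightarrow> (\<forall>j\<in>{0..N + 1}. q j = 0 \<longrightarrow> p j = 0)"

definition rel_entropy_real :: "nat \<Rightarrow> (nat \<Rightarrow> real) \<Rightarrow> (nat \<Rightarrow> real) \<Rightarrow> real" where
  "rel_entropy_real N p q = (\<Sum>j = 0..N + 1. p j * ln (p j / q j))"

lemma rel_entropy_eq:
  "rel_entropy N p q = (if abs_cont N p q then ereal (rel_entropy_real N p q) else \<infinity>)"
proof (cases "abs_cont N p q")
  case True
  then have "rel_entropy N p q = (\<Sum>j = 0..N + 1. ereal (p j * ln (p j / q j)))"
    unfolding rel_entropy_def abs_cont_def
    by (intro sum.cong) (auto simp: rel_entropy_term_def)
  then show ?thesis using True by (simp add: rel_entropy_real_def)
next
  case False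
  then obtain j where "j \<in> {0..N + 1}" "rel_entropy_term (p j) (q j) = \<infinity>"
    by (auto simp: abs_cont_def rel_entropy_term_def)
  then have "rel_entropy N p q = \<infinity>"
    unfolding rel_entropy_def sum_Pinfty by auto
  then show ?thesis using False by simp
qed

lemma sum_rel_entropy_le_iff:
  fixes q r :: "'d::finite \<Rightarrow> nat \<Rightarrow> real"
  shows "(\<Sum>i\<in>UNIV. rel_entropy N (q i) (r i)) \<le> ereal t \<longleftrightarrow>
    (\<forall>i. abs_cont N (q i) (r i)) \<and> (\<Sum>i\<in>UNIV. rel_entropy_real N (q i) (r i)) \<le> t"
proof (cases "\<forall>i. abs_cont N (q i) (r i)")
  case True
  then show ?thesis by (simp add: rel_entropy_eq)
next
  case False
  then have "(\<Sum>i\<in>UNIV. rel_entropy N (q i) (r i)) = \<infinity>"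
    unfolding sum_Pinfty by (auto simp: rel_entropy_eq)
  then show ?thesis using False by simp
qed

lemma rel_entropy_real_jointly_convex:
  assumes "\<And>j. j \<in> {0..N + 1} \<Longrightarrow> 0 \<le> p j \<and> 0 \<le> q j \<and> 0 \<le> p' j \<and> 0 \<le> q' j"
    and "abs_cont N p q" "abs_cont N p' q'" and a: "0 \<le> a" and b: "0 \<le> b"
  shows "rel_entropy_real N (\<lambda>j. a * p j + b * p' j) (\<lambda>j. a * q j + b * q' j)
    \<le> a * rel_entropy_real N p q + b * rel_entropy_real N p' q'"
proof -
  have "rel_entropy_real N (\<lambda>j. a * p j + b * p' j) (\<lambda>j. a * q j + b * q' j)
     \<le> (\<Sum>j = 0..N + 1. a * p j * ln (a * p j / (a * q j)) + b * p' j * ln (b * p' j / (b * q' j)))"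
    unfolding rel_entropy_real_def
    using assms by (intro sum_mono log_sum_inequality_two) (auto simp: abs_cont_def)
  also have "\<dots> = a * rel_entropy_real N p q + b * rel_entropy_real N p' q'"
    unfolding rel_entropy_real_def sum_distrib_left sum.distrib[symmetric]
    by (intro sum.cong) auto
  finally show ?thesis .
qed

lemma prob_simplexD:
  assumes "p \<in> prob_simplex N"
  shows "j \<le> N + 1 \<Longrightarrow> 0 \<le> p j" "(\<Sum>j = 0..N + 1. p j) = 1"
  using assms by (auto simp: prob_simplex_def)

lemma prob_simplex_convex:
  assumes "p \<in> prob_simplex N" "q \<in> prob_simplex N" "0 \<le> a" "0 \<le> b" "a + b = 1"
  shows "(\<lambda>j. a * p j + b * q j) \<in> prob_simplex N"
proof -
  have "(\<Sum>j = 0..N + 1. a * p j + b * q j) = a * (\<Sum>j = 0..N + 1. p j) + b * (\<Sum>j = 0..N + 1. q j)"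
    by (simp only: sum.distrib sum_distrib_left)
  then show ?thesis using assms by (simp add: prob_simplex_def)
qed

section \<open>Gibbs' variational principle\<close>

definition exp_moment :: "nat \<Rightarrow> (nat \<Rightarrow> real) \<Rightarrow> (nat \<Rightarrow> real) \<Rightarrow> real" where
  "exp_moment N r a = (\<Sum>j = 0..N + 1. r j * exp (a j))"

lemma exp_moment_pos:
  assumes "r \<in> prob_simplex N"
  shows "0 < exp_moment N r a"
proof -
  have "\<exists>j\<in>{0..N+1}. r j \<noteq> 0"
    using prob_simplexD(2)[OF assms] by (metis sum.neutral zero_neq_one)
  then obtain j where j: "j \<in> {0..N+1}" "r j > 0"
    using prob_simplexD(1)[OF assms] by (metis atLeastAtMost_iff order_le_less)
  show ?thesis
    unfolding exp_moment_def using j prob_simplexD(1)[OF assms]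
    by (intro sum_pos2[of _ j]) auto
qed

text \<open>One half of the conjugacy between relative entropy and log-moments: add up the tangents with slopes
\<open>c = exp (a j) / Z\<close>. Allowing an upper bound \<open>Z\<close> in place of the moment itself makes the inequality
applicable to the maximum over two moments.\<close>
lemma gibbs_inequality:
  assumes q: "q \<in> prob_simplex N" and r: "r \<in> prob_simplex N" and ac: "abs_cont N q r"
    and Z: "exp_moment N r a \<le> Z"
  shows "(\<Sum>j = 0..N + 1. a j * q j) \<le> rel_entropy_real N q r + ln Z"
proof -
  have Zpos: "0 < Z" using exp_moment_pos[OF r, of a] Z by linarith
  have "(\<Sum>j = 0..N + 1. q j * ln (exp (a j) / Z) + q j - exp (a j) / Z * r j) =
     (\<Sum>j = 0..N + 1. a j * q j - ln Z * q j + q j - r j * exp (a j) / Z)"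
    using Zpos by (intro sum.cong) (auto simp: ln_div algebra_simps)
  also have "\<dots> = (\<Sum>j = 0..N + 1. a j * q j) - ln Z + 1 - exp_moment N r a / Z"
    using prob_simplexD(2)[OF q]
    by (simp only: sum.distrib sum_subtractf exp_moment_def sum_divide_distrib mult_1_right
        flip: sum_distrib_left)
  finally have "(\<Sum>j = 0..N + 1. a j * q j) - ln Z + 1 - exp_moment N r a / Z =
      (\<Sum>j = 0..N + 1. q j * ln (exp (a j) / Z) + q j - exp (a j) / Z * r j)" ..
  also have "\<dots> \<le> rel_entropy_real N q r"
    unfolding rel_entropy_real_def
    using ac Zpos prob_simplexD(1)[OF q] prob_simplexD(1)[OF r]
    by (intro sum_mono rel_entropy_term_tangent) (auto simp: abs_cont_def)
  moreover have "exp_moment N r a / Z \<le> 1" using Z Zpos by simp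
  ultimately show ?thesis by linarith
qed

text \<open>The tangents touch when \<open>p j / r j\<close> is the slope, that is, at the exponentially tilted distribution.\<close>
lemma gibbs_equality:
  assumes r: "r \<in> prob_simplex N"
  obtains q where "q \<in> prob_simplex N" "abs_cont N q r"
    "(\<Sum>j = 0..N + 1. a j * q j) = rel_entropy_real N q r + ln (exp_moment N r a)"
proof
  define Z where "Z = exp_moment N r a"
  define q where "q j = r j * exp (a j) / Z" for j
  have Zpos: "0 < Z" using exp_moment_pos[OF r] by (simp add: Z_def)
  have "(\<Sum>j = 0..N + 1. q j) = 1"
    using Zpos unfolding q_def sum_divide_distrib[symmetric] exp_moment_def[symmetric] Z_def by simp
  then show q: "q \<in> prob_simplex N"
    using Zpos prob_simplexD(1)[OF r] by (simp add: prob_simplex_def q_def)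
  show "abs_cont N q r" by (simp add: abs_cont_def q_def)
  have "rel_entropy_real N q r = (\<Sum>j = 0..N + 1. a j * q j - ln Z * q j)"
    unfolding rel_entropy_real_def
  proof (intro sum.cong refl)
    fix j
    show "q j * ln (q j / r j) = a j * q j - ln Z * q j"
      using Zpos by (cases "r j = 0") (auto simp: q_def ln_div algebra_simps diff_divide_distrib)
  qed
  also have "\<dots> = (\<Sum>j = 0..N + 1. a j * q j) - ln Z"
    using prob_simplexD(2)[OF q] by (simp only: sum_subtractf mult_1_right flip: sum_distrib_left)
  finally show "(\<Sum>j = 0..N + 1. a j * q j) = rel_entropy_real N q r + ln (exp_moment N r a)"
    by (simp add: Z_def)
qed

section \<open>The extremal distributions\<close>

text \<open>The vector is defined by listing its entries; its meaning is this distribution function, the largest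
one that stays within \<open>\<Gamma>\<close> of the empirical one: mass \<open>\<Gamma>\<close> sits on the left end point, and the
equally weighted samples are used up from the left until the total is \<open>1\<close>.\<close>
lemma qL_cumulative:
  assumes "1 \<le> N" "0 \<le> \<Gamma>" "\<Gamma> \<le> 1"
  shows "(\<Sum>k = 0..j. qL N \<Gamma> k) = min 1 (\<Gamma> + real j / real N)"
proof -
  define m where "m = nat \<lfloor>real N * (1 - \<Gamma>)\<rfloor>"
  have q: "qL N \<Gamma> k = (if k = 0 then \<Gamma> else if k \<le> m then 1 / real N
      else if k = m + 1 then 1 - \<Gamma> - real m / real N else 0)" for k
    by (simp add: qL_def m_def Let_def)
  have "(\<Sum>k = 0..j. qL N \<Gamma> k) = (if j \<le> m then \<Gamma> + real j / real N else 1)"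
    using assms(1) by (induction j) (auto simp: q field_simps)
  moreover have "j \<le> m \<longleftrightarrow> \<Gamma> + real j / real N \<le> 1"
  proof -
    have "j \<le> m \<longleftrightarrow> real j \<le> real N * (1 - \<Gamma>)"
      using assms unfolding m_def by (auto simp: le_nat_iff le_floor_iff)
    also have "\<dots> \<longleftrightarrow> \<Gamma> + real j / real N \<le> 1"
      using assms(1) by (simp add: field_simps)
    finally show ?thesis .
  qed
  ultimately show ?thesis by (auto simp: min_def)
qed

lemma qL_nonneg:
  assumes "1 \<le> N" "0 \<le> \<Gamma>" "\<Gamma> \<le> 1"
  shows "0 \<le> qL N \<Gamma> j"
proof (cases j)
  case 0
  then show ?thesis using assms by (simp add: qL_def)
next
  case (Suc k)
  have "qL N \<Gamma> j = (\<Sum>k = 0..j. qL N \<Gamma> k) - (\<Sum>k = 0..k. qL N \<Gamma> k)"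
    using Suc by simp
  also have "\<dots> = min 1 (\<Gamma> + real j / real N) - min 1 (\<Gamma> + real k / real N)"
    by (simp only: qL_cumulative[OF assms])
  also have "0 \<le> \<dots>"
  proof -
    have "real k / real N \<le> real j / real N" using Suc by (intro divide_right_mono) auto
    then show ?thesis by (simp add: min_def)
  qed
  finally show ?thesis .
qed

lemma qL_simplex:
  assumes "1 \<le> N" "0 \<le> \<Gamma>" "\<Gamma> \<le> 1"
  shows "qL N \<Gamma> \<in> prob_simplex N"
proof -
  have "(\<Sum>k = 0..N + 1. qL N \<Gamma> k) = 1"
    using assms(1,2) by (simp only: qL_cumulative[OF assms]) (simp add: field_simps)
  then show ?thesis using qL_nonneg[OF assms] by (simp add: prob_simplex_def)
qed

lemma sum_qR:
  "(\<Sum>j = 0..N + 1. qR N \<Gamma> j * f j) = (\<Sum>j = 0..N + 1. qL N \<Gamma> j * f (N + 1 - j))"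
  unfolding qR_def
  by (rule sum.reindex_bij_witness[of _ "\<lambda>j. N + 1 - j" "\<lambda>j. N + 1 - j"]) auto

lemma qR_simplex:
  assumes "1 \<le> N" "0 \<le> \<Gamma>" "\<Gamma> \<le> 1"
  shows "qR N \<Gamma> \<in> prob_simplex N"
proof -
  have "(\<Sum>j = 0..N + 1. qR N \<Gamma> j) = 1"
    using sum_qR[of N \<Gamma> "\<lambda>_. 1"] prob_simplexD(2)[OF qL_simplex[OF assms]] by simp
  then show ?thesis using qL_nonneg[OF assms] by (simp add: prob_simplex_def qR_def)
qed

definition mix_qLR :: "nat \<Rightarrow> real \<Rightarrow> real \<Rightarrow> nat \<Rightarrow> real" where
  "mix_qLR N \<Gamma> \<theta> j = \<theta> * qL N \<Gamma> j + (1 - \<theta>) * qR N \<Gamma> j"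

lemma mix_qLR_simplex:
  assumes "1 \<le> N" "0 \<le> \<Gamma>" "\<Gamma> \<le> 1" "0 \<le> \<theta>" "\<theta> \<le> 1"
  shows "mix_qLR N \<Gamma> \<theta> \<in> prob_simplex N"
  unfolding mix_qLR_def[abs_def]
  using assms by (intro prob_simplex_convex qL_simplex qR_simplex) auto

definition worst_exp_moment :: "nat \<Rightarrow> real \<Rightarrow> (nat \<Rightarrow> real) \<Rightarrow> real" where
  "worst_exp_moment N \<Gamma> a = max (exp_moment N (qL N \<Gamma>) a) (exp_moment N (qR N \<Gamma>) a)"

text \<open>A moment is linear in the distribution, so over the segment between the two extremal distributions it
is largest at an end point. This is the source of the maximum in the dual expression.\<close>
lemma exp_moment_mix_le_worst:
  assumes "0 \<le> \<theta>" "\<theta> \<le> 1"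
  shows "exp_moment N (mix_qLR N \<Gamma> \<theta>) a \<le> worst_exp_moment N \<Gamma> a"
proof -
  have "exp_moment N (mix_qLR N \<Gamma> \<theta>) a = \<theta> * exp_moment N (qL N \<Gamma>) a + (1 - \<theta>) * exp_moment N (qR N \<Gamma>) a"
    unfolding exp_moment_def mix_qLR_def sum_distrib_left sum.distrib[symmetric]
    by (intro sum.cong) (auto simp: algebra_simps)
  also have "\<dots> \<le> worst_exp_moment N \<Gamma> a"
    unfolding worst_exp_moment_def using assms by (intro convex_bound_le) auto
  finally show ?thesis .
qed

lemma dual_expr_eq:
  "dual_expr N \<Gamma> h \<epsilon> v \<mu> =
    \<mu> * ln (1 / \<epsilon>) + (\<Sum>i\<in>UNIV. \<mu> * ln (worst_exp_moment N \<Gamma> (\<lambda>j. v $ i * h i j / \<mu>)))"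
  by (simp add: dual_expr_def worst_exp_moment_def exp_moment_def sum_distrib_left)

section \<open>The uncertainty set as a level of a convex epigraph\<close>

text \<open>Pairs of a point and an upper bound on the entropy at which it is attained. The uncertainty set is the
slice at height \<open>ln (1 / \<epsilon>)\<close>, so the convexity of this one set serves both the duality argument and the
separation of the uncertainty set from \<open>{u. f u > 0}\<close>.\<close>
definition entropy_epigraph ::
  "nat \<Rightarrow> real \<Rightarrow> ('d \<Rightarrow> nat \<Rightarrow> real) \<Rightarrow> ((real ^ 'd::finite) \<times> real) set" where
  "entropy_epigraph N \<Gamma> h = {(u, t). \<exists>\<theta> q. (\<forall>i. 0 \<le> \<theta> i \<and> \<theta> i \<le> 1) \<and>
     (\<forall>i. q i \<in> prob_simplex N \<and> abs_cont N (q i) (mix_qLR N \<Gamma> (\<theta> i))) \<and>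
     (\<forall>i. (\<Sum>j = 0..N + 1. h i j * q i j) = u $ i) \<and>
     (\<Sum>i\<in>UNIV. rel_entropy_real N (q i) (mix_qLR N \<Gamma> (\<theta> i))) \<le> t}"

lemma mem_U_indep_iff: "u \<in> U_indep N \<Gamma> h \<epsilon> \<longleftrightarrow> (u, ln (1 / \<epsilon>)) \<in> entropy_epigraph N \<Gamma> h"
proof -
  have mix: "(\<lambda>j. \<theta> * qL N \<Gamma> j + (1 - \<theta>) * qR N \<Gamma> j) = mix_qLR N \<Gamma> \<theta>" for \<theta>
    by (rule ext) (simp add: mix_qLR_def)
  show ?thesis
    unfolding U_indep_def entropy_epigraph_def mem_Collect_eq case_prod_conv mix sum_rel_entropy_le_iff
    by (intro ex_cong1) blast
qed

lemma entropy_epigraphI: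
  fixes u :: "real ^ 'd::finite"
  assumes "\<And>i. 0 \<le> \<theta> i \<and> \<theta> i \<le> 1" "\<And>i. q i \<in> prob_simplex N"
    "\<And>i. abs_cont N (q i) (mix_qLR N \<Gamma> (\<theta> i))"
    "\<And>i. (\<Sum>j = 0..N + 1. h i j * q i j) = u $ i"
    "(\<Sum>i\<in>UNIV. rel_entropy_real N (q i) (mix_qLR N \<Gamma> (\<theta> i))) \<le> t"
  shows "(u, t) \<in> entropy_epigraph N \<Gamma> h"
  using assms unfolding entropy_epigraph_def by blast

lemma entropy_epigraph_mono:
  assumes "(u, t) \<in> entropy_epigraph N \<Gamma> h" "t \<le> t'"
  shows "(u, t') \<in> entropy_epigraph N \<Gamma> h"
proof -
  obtain \<theta> q where "\<And>i. 0 \<le> \<theta> i \<and> \<theta> i \<le> 1" "\<And>i. q i \<in> prob_simplex N"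
    "\<And>i. abs_cont N (q i) (mix_qLR N \<Gamma> (\<theta> i))"
    "\<And>i. (\<Sum>j = 0..N + 1. h i j * q i j) = u $ i"
    "(\<Sum>i\<in>UNIV. rel_entropy_real N (q i) (mix_qLR N \<Gamma> (\<theta> i))) \<le> t"
    using assms(1) unfolding entropy_epigraph_def by blast
  then show ?thesis using assms(2) by (intro entropy_epigraphI[of \<theta> q]) auto
qed

text \<open>The parameter \<open>\<theta>\<close> enters the reference distribution linearly, so joint convexity of relative entropy
in both arguments allows \<open>\<theta>\<close> and \<open>q\<close> to be averaged at the same time.\<close>
lemma convex_entropy_epigraph:
  fixes h :: "'d::finite \<Rightarrow> nat \<Rightarrow> real"
  assumes N: "1 \<le> N" "0 \<le> \<Gamma>" "\<Gamma> \<le> 1"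
  shows "convex (entropy_epigraph N \<Gamma> h)"
proof (rule convexI, clarsimp)
  fix u u' :: "real ^ 'd" and t t' a b :: real
  assume 1: "(u, t) \<in> entropy_epigraph N \<Gamma> h" and 2: "(u', t') \<in> entropy_epigraph N \<Gamma> h"
    and ab: "0 \<le> a" "0 \<le> b" "a + b = 1"
  obtain \<theta> q where th: "\<And>i. 0 \<le> \<theta> i \<and> \<theta> i \<le> 1" and q: "\<And>i. q i \<in> prob_simplex N"
    "\<And>i. abs_cont N (q i) (mix_qLR N \<Gamma> (\<theta> i))"
    "\<And>i. (\<Sum>j = 0..N + 1. h i j * q i j) = u $ i"
    "(\<Sum>i\<in>UNIV. rel_entropy_real N (q i) (mix_qLR N \<Gamma> (\<theta> i))) \<le> t"
    using 1 unfolding entropy_epigraph_def by blast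
  obtain \<theta>' q' where th': "\<And>i. 0 \<le> \<theta>' i \<and> \<theta>' i \<le> 1" and q': "\<And>i. q' i \<in> prob_simplex N"
    "\<And>i. abs_cont N (q' i) (mix_qLR N \<Gamma> (\<theta>' i))"
    "\<And>i. (\<Sum>j = 0..N + 1. h i j * q' i j) = u' $ i"
    "(\<Sum>i\<in>UNIV. rel_entropy_real N (q' i) (mix_qLR N \<Gamma> (\<theta>' i))) \<le> t'"
    using 2 unfolding entropy_epigraph_def by blast
  define \<theta>'' where "\<theta>'' i = a * \<theta> i + b * \<theta>' i" for i
  define q'' where "q'' i = (\<lambda>j. a * q i j + b * q' i j)" for i
  have b: "b = 1 - a" using ab by simp
  have mix: "mix_qLR N \<Gamma> (\<theta>'' i) =
      (\<lambda>j. a * mix_qLR N \<Gamma> (\<theta> i) j + b * mix_qLR N \<Gamma> (\<theta>' i) j)" for i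
    by (rule ext) (simp add: mix_qLR_def \<theta>''_def b algebra_simps)
  have pos: "0 \<le> mix_qLR N \<Gamma> (\<theta> i) j" "0 \<le> mix_qLR N \<Gamma> (\<theta>' i) j"
    if "j \<in> {0..N+1}" for i j
    using that th th' by (auto intro!: prob_simplexD(1)[OF mix_qLR_simplex[OF N]])
  have pos': "0 \<le> q i j" "0 \<le> q' i j" if "j \<in> {0..N+1}" for i j
    using that prob_simplexD(1)[OF q(1)] prob_simplexD(1)[OF q'(1)] by auto
  have D: "rel_entropy_real N (q'' i) (mix_qLR N \<Gamma> (\<theta>'' i)) \<le>
      a * rel_entropy_real N (q i) (mix_qLR N \<Gamma> (\<theta> i)) +
      b * rel_entropy_real N (q' i) (mix_qLR N \<Gamma> (\<theta>' i))" for i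
    unfolding q''_def mix
    by (intro rel_entropy_real_jointly_convex conjI pos pos' q(2) q'(2) ab)
  show "(a *\<^sub>R u + b *\<^sub>R u', a * t + b * t') \<in> entropy_epigraph N \<Gamma> h"
  proof (rule entropy_epigraphI)
    show "0 \<le> \<theta>'' i \<and> \<theta>'' i \<le> 1" for i
      using th[of i] th'[of i] ab unfolding \<theta>''_def by (auto intro!: convex_bound_le)
    show "q'' i \<in> prob_simplex N" for i
      unfolding q''_def using q q' ab by (intro prob_simplex_convex) auto
    show "abs_cont N (q'' i) (mix_qLR N \<Gamma> (\<theta>'' i))" for i
      unfolding abs_cont_def
    proof safe
      fix j assume j: "j \<in> {0..N+1}" and "mix_qLR N \<Gamma> (\<theta>'' i) j = 0"
      then have "a * mix_qLR N \<Gamma> (\<theta> i) j = 0 \<and> b * mix_qLR N \<Gamma> (\<theta>' i) j = 0"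
        using pos[OF j] ab unfolding mix by (simp add: add_nonneg_eq_0_iff)
      then show "q'' i j = 0"
        using q(2) q'(2) j by (auto simp: abs_cont_def q''_def)
    qed
    show "(\<Sum>j = 0..N + 1. h i j * q'' i j) = (a *\<^sub>R u + b *\<^sub>R u') $ i" for i
    proof -
      have "(\<Sum>j = 0..N + 1. h i j * q'' i j) =
          a * (\<Sum>j = 0..N + 1. h i j * q i j) + b * (\<Sum>j = 0..N + 1. h i j * q' i j)"
        unfolding q''_def sum_distrib_left sum.distrib[symmetric]
        by (intro sum.cong) (auto simp: algebra_simps)
      then show ?thesis by (simp only: q q') simp
    qed
    have "(\<Sum>i\<in>UNIV. rel_entropy_real N (q'' i) (mix_qLR N \<Gamma> (\<theta>'' i))) \<le>
       a * (\<Sum>i\<in>UNIV. rel_entropy_real N (q i) (mix_qLR N \<Gamma> (\<theta> i))) +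
       b * (\<Sum>i\<in>UNIV. rel_entropy_real N (q' i) (mix_qLR N \<Gamma> (\<theta>' i)))"
      unfolding sum_distrib_left sum.distrib[symmetric] by (intro sum_mono D)
    also have "\<dots> \<le> a * t + b * t'"
      using q(4) q'(4) ab by (intro add_mono mult_left_mono)
    finally show "(\<Sum>i\<in>UNIV. rel_entropy_real N (q'' i) (mix_qLR N \<Gamma> (\<theta>'' i))) \<le> a * t + b * t'" .
  qed
qed

lemma convex_U_indep:
  fixes h :: "'d::finite \<Rightarrow> nat \<Rightarrow> real"
  assumes N: "1 \<le> N" "0 \<le> \<Gamma>" "\<Gamma> \<le> 1"
  shows "convex (U_indep N \<Gamma> h \<epsilon>)"
proof (rule convexI)
  fix u u' :: "real ^ 'd" and a b :: real
  assume "u \<in> U_indep N \<Gamma> h \<epsilon>" "u' \<in> U_indep N \<Gamma> h \<epsilon>" "0 \<le> a" "0 \<le> b" "a + b = 1"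
  then have "a *\<^sub>R (u, ln (1 / \<epsilon>)) + b *\<^sub>R (u', ln (1 / \<epsilon>)) \<in> entropy_epigraph N \<Gamma> h"
    by (intro convexD[OF convex_entropy_epigraph[OF N]]) (auto simp: mem_U_indep_iff)
  then show "a *\<^sub>R u + b *\<^sub>R u' \<in> U_indep N \<Gamma> h \<epsilon>"
    using \<open>a + b = 1\<close> by (simp add: mem_U_indep_iff flip: distrib_right)
qed

text \<open>Taking \<open>q\<close> equal to the reference distribution costs no entropy. As \<open>ln (1 / \<epsilon>) > 0\<close>, this is the
strictly feasible point that excludes a vertical separating line in the duality argument.\<close>
lemma entropy_epigraph_slater:
  fixes h :: "'d::finite \<Rightarrow> nat \<Rightarrow> real"
  assumes N: "1 \<le> N" "0 \<le> \<Gamma>" "\<Gamma> \<le> 1"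
  obtains u where "\<And>t. 0 \<le> t \<Longrightarrow> (u, t) \<in> entropy_epigraph N \<Gamma> h"
proof
  define u :: "real ^ 'd" where "u = (\<chi> i. \<Sum>j = 0..N + 1. h i j * qL N \<Gamma> j)"
  have mix: "mix_qLR N \<Gamma> 1 = qL N \<Gamma>" by (rule ext) (simp add: mix_qLR_def)
  have "rel_entropy_real N (qL N \<Gamma>) (qL N \<Gamma>) = 0"
    unfolding rel_entropy_real_def by (intro sum.neutral) auto
  then show "(u, t) \<in> entropy_epigraph N \<Gamma> h" if "0 \<le> t" for t
    using that qL_simplex[OF N]
    by (intro entropy_epigraphI[where \<theta> = "\<lambda>_. 1" and q = "\<lambda>_. qL N \<Gamma>"])
       (auto simp: mix abs_cont_def u_def)
qed

section \<open>Lagrangian duality\<close>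

lemma inner_eq_sum_weighted:
  fixes v u :: "real ^ 'd::finite"
  assumes "\<And>i. (\<Sum>j = 0..N + 1. h i j * q i j) = u $ i"
  shows "v \<bullet> u = (\<Sum>i\<in>UNIV. \<Sum>j = 0..N + 1. v $ i * h i j * q i j)"
  unfolding inner_vec_def inner_real_def assms[symmetric] sum_distrib_left
  by (simp add: mult.assoc)

lemma weak_duality:
  fixes u v :: "real ^ 'd::finite"
  assumes N: "1 \<le> N" "0 \<le> \<Gamma>" "\<Gamma> \<le> 1" and mem: "(u, t) \<in> entropy_epigraph N \<Gamma> h" and mu: "0 < \<mu>"
  shows "v \<bullet> u \<le> \<mu> * t + (\<Sum>i\<in>UNIV. \<mu> * ln (worst_exp_moment N \<Gamma> (\<lambda>j. v $ i * h i j / \<mu>)))"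
proof -
  obtain \<theta> q where th: "\<And>i. 0 \<le> \<theta> i \<and> \<theta> i \<le> 1" and q: "\<And>i. q i \<in> prob_simplex N"
    "\<And>i. abs_cont N (q i) (mix_qLR N \<Gamma> (\<theta> i))"
    "\<And>i. (\<Sum>j = 0..N + 1. h i j * q i j) = u $ i"
    "(\<Sum>i\<in>UNIV. rel_entropy_real N (q i) (mix_qLR N \<Gamma> (\<theta> i))) \<le> t"
    using mem unfolding entropy_epigraph_def by blast
  have "(\<Sum>j = 0..N + 1. v $ i * h i j / \<mu> * q i j) \<le>
      rel_entropy_real N (q i) (mix_qLR N \<Gamma> (\<theta> i)) + ln (worst_exp_moment N \<Gamma> (\<lambda>j. v $ i * h i j / \<mu>))" for i
    using th N by (intro gibbs_inequality q exp_moment_mix_le_worst mix_qLR_simplex) auto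
  then have "\<mu> * (\<Sum>j = 0..N + 1. v $ i * h i j / \<mu> * q i j) \<le>
      \<mu> * (rel_entropy_real N (q i) (mix_qLR N \<Gamma> (\<theta> i)) + ln (worst_exp_moment N \<Gamma> (\<lambda>j. v $ i * h i j / \<mu>)))" for i
    using mu by (intro mult_left_mono) auto
  moreover have "\<mu> * (\<Sum>j = 0..N + 1. v $ i * h i j / \<mu> * q i j) = (\<Sum>j = 0..N + 1. v $ i * h i j * q i j)" for i
    unfolding sum_distrib_left using mu by (intro sum.cong) auto
  ultimately have "(\<Sum>i\<in>UNIV. \<Sum>j = 0..N + 1. v $ i * h i j * q i j) \<le>
     (\<Sum>i\<in>UNIV. \<mu> * (rel_entropy_real N (q i) (mix_qLR N \<Gamma> (\<theta> i)) + ln (worst_exp_moment N \<Gamma> (\<lambda>j. v $ i * h i j / \<mu>))))"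
    by (intro sum_mono) metis
  also have "\<dots> = \<mu> * (\<Sum>i\<in>UNIV. rel_entropy_real N (q i) (mix_qLR N \<Gamma> (\<theta> i))) +
     (\<Sum>i\<in>UNIV. \<mu> * ln (worst_exp_moment N \<Gamma> (\<lambda>j. v $ i * h i j / \<mu>)))"
    by (simp add: distrib_left sum.distrib sum_distrib_left)
  finally show ?thesis
    using mult_left_mono[OF q(4), of \<mu>] mu unfolding inner_eq_sum_weighted[OF q(3)] by linarith
qed

text \<open>In each coordinate pick the end point \<open>\<theta> \<in> {0, 1}\<close> with the larger moment and tilt the corresponding
extremal distribution; then the inequality of weak duality becomes an equality.\<close>
lemma lagrangian_attained:
  fixes v :: "real ^ 'd::finite"
  assumes N: "1 \<le> N" "0 \<le> \<Gamma>" "\<Gamma> \<le> 1" and mu: "0 < \<mu>"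
  obtains u t where "(u, t) \<in> entropy_epigraph N \<Gamma> h"
    "v \<bullet> u = \<mu> * t + (\<Sum>i\<in>UNIV. \<mu> * ln (worst_exp_moment N \<Gamma> (\<lambda>j. v $ i * h i j / \<mu>)))"
proof -
  define a where "a i j = v $ i * h i j / \<mu>" for i j
  define attains where "attains i \<theta> q \<longleftrightarrow> (0 \<le> \<theta> \<and> \<theta> \<le> 1) \<and> q \<in> prob_simplex N \<and>
    abs_cont N q (mix_qLR N \<Gamma> \<theta>) \<and> (\<Sum>j = 0..N + 1. a i j * q j) =
      rel_entropy_real N q (mix_qLR N \<Gamma> \<theta>) + ln (worst_exp_moment N \<Gamma> (a i))" for i \<theta> q
  have "\<exists>\<theta> q. attains i \<theta> q" for i
  proof -
    define \<theta> where "\<theta> = (if exp_moment N (qR N \<Gamma>) (a i) \<le> exp_moment N (qL N \<Gamma>) (a i) then 1 else 0 :: real)"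
    have th: "0 \<le> \<theta>" "\<theta> \<le> 1" by (auto simp: \<theta>_def)
    have "worst_exp_moment N \<Gamma> (a i) = exp_moment N (mix_qLR N \<Gamma> \<theta>) (a i)"
      by (auto simp: worst_exp_moment_def mix_qLR_def[abs_def] \<theta>_def exp_moment_def)
    then show ?thesis
      using gibbs_equality[OF mix_qLR_simplex[OF N th], of "a i"] th unfolding attains_def by metis
  qed
  then obtain \<theta> q where "\<And>i. attains i (\<theta> i) (q i)" by metis
  then have 1: "0 \<le> \<theta> i \<and> \<theta> i \<le> 1" "q i \<in> prob_simplex N"
    "abs_cont N (q i) (mix_qLR N \<Gamma> (\<theta> i))"
    "(\<Sum>j = 0..N + 1. a i j * q i j) =
        rel_entropy_real N (q i) (mix_qLR N \<Gamma> (\<theta> i)) + ln (worst_exp_moment N \<Gamma> (a i))" for i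
    unfolding attains_def by blast+
  define u where "u = (\<chi> i. \<Sum>j = 0..N + 1. h i j * q i j)"
  define t where "t = (\<Sum>i\<in>UNIV. rel_entropy_real N (q i) (mix_qLR N \<Gamma> (\<theta> i)))"
  have mem: "(u, t) \<in> entropy_epigraph N \<Gamma> h"
    using 1 by (intro entropy_epigraphI[of \<theta> q]) (auto simp: u_def t_def)
  have "v \<bullet> u = (\<Sum>i\<in>UNIV. \<Sum>j = 0..N + 1. v $ i * h i j * q i j)"
    by (intro inner_eq_sum_weighted) (simp add: u_def)
  also have "\<dots> = (\<Sum>i\<in>UNIV. \<mu> * (\<Sum>j = 0..N + 1. a i j * q i j))"
    unfolding sum_distrib_left a_def using mu by (intro sum.cong) auto
  also have "\<dots> = \<mu> * t + (\<Sum>i\<in>UNIV. \<mu> * ln (worst_exp_moment N \<Gamma> (a i)))"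
    by (simp only: 1(4) t_def distrib_left sum.distrib sum_distrib_left)
  finally show ?thesis using mem by (intro that) (simp_all add: a_def[abs_def])
qed

text \<open>As \<open>\<mu>\<close> decreases to \<open>0\<close>, the largest exponent \<open>a k\<close> among the atoms of the two extremal distributions
dominates: the moment lies between \<open>w exp (a k / \<mu>)\<close> and \<open>exp (a k / \<mu>)\<close>, where \<open>w > 0\<close> is the larger
weight of the atom \<open>k\<close>.\<close>
lemma log_worst_exp_moment_tendsto:
  assumes N: "1 \<le> N" "0 \<le> \<Gamma>" "\<Gamma> \<le> 1"
  obtains k where "k \<le> N + 1" "0 < qL N \<Gamma> k \<or> 0 < qR N \<Gamma> k"
    "((\<lambda>\<mu>. \<mu> * ln (worst_exp_moment N \<Gamma> (\<lambda>j. a j / \<mu>))) \<longlongrightarrow> a k) (at_right 0)"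
proof -
  define J where "J = {j \<in> {0..N+1}. 0 < qL N \<Gamma> j \<or> 0 < qR N \<Gamma> j}"
  note L = qL_simplex[OF N] and R = qR_simplex[OF N]
  have "\<exists>j\<in>{0..N+1}. qL N \<Gamma> j \<noteq> 0"
    using prob_simplexD(2)[OF L] by (metis sum.neutral zero_neq_one)
  then have "J \<noteq> {}"
    unfolding J_def using qL_nonneg[OF N] by (auto simp: order_less_le)
  moreover have "finite J" unfolding J_def by simp
  ultimately have "Max (a ` J) \<in> a ` J" and max: "\<And>j. j \<in> J \<Longrightarrow> a j \<le> Max (a ` J)"
    by (auto intro!: Max_in)
  then obtain k where k: "k \<in> J" and ak: "\<And>j. j \<in> J \<Longrightarrow> a j \<le> a k" by auto
  define w where "w = max (qL N \<Gamma> k) (qR N \<Gamma> k)"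
  have w: "0 < w" using k by (auto simp: w_def J_def less_max_iff_disj)
  have up: "exp_moment N r (\<lambda>j. a j / \<mu>) \<le> exp (a k / \<mu>)"
    if r: "r \<in> prob_simplex N" "\<And>j. j \<in> {0..N+1} \<Longrightarrow> 0 < r j \<Longrightarrow> j \<in> J" and "0 < \<mu>" for r \<mu>
  proof -
    have "exp_moment N r (\<lambda>j. a j / \<mu>) \<le> (\<Sum>j = 0..N + 1. r j * exp (a k / \<mu>))"
      unfolding exp_moment_def
    proof (intro sum_mono)
      fix j assume j: "j \<in> {0..N+1}"
      show "r j * exp (a j / \<mu>) \<le> r j * exp (a k / \<mu>)"
        using prob_simplexD(1)[OF r(1), of j] j r(2)[OF j] ak[of j] \<open>0 < \<mu>\<close>
        by (cases "r j = 0") (auto simp: divide_le_cancel)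
    qed
    also have "\<dots> = exp (a k / \<mu>)"
      using prob_simplexD(2)[OF r(1)] by (simp only: sum_distrib_right[symmetric])
    finally show ?thesis .
  qed
  have upper: "\<mu> * ln (worst_exp_moment N \<Gamma> (\<lambda>j. a j / \<mu>)) \<le> a k" if "0 < \<mu>" for \<mu>
  proof -
    have "worst_exp_moment N \<Gamma> (\<lambda>j. a j / \<mu>) \<le> exp (a k / \<mu>)"
      unfolding worst_exp_moment_def using that by (auto intro!: up L R simp: J_def)
    moreover have "0 < worst_exp_moment N \<Gamma> (\<lambda>j. a j / \<mu>)"
      unfolding worst_exp_moment_def using exp_moment_pos[OF L] by (simp add: less_max_iff_disj)
    ultimately have "ln (worst_exp_moment N \<Gamma> (\<lambda>j. a j / \<mu>)) \<le> a k / \<mu>"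
      by (metis ln_exp ln_le_cancel_iff exp_gt_zero)
    then show ?thesis using that by (simp add: field_simps)
  qed
  have lower: "\<mu> * ln w + a k \<le> \<mu> * ln (worst_exp_moment N \<Gamma> (\<lambda>j. a j / \<mu>))" if "0 < \<mu>" for \<mu>
  proof -
    have "r k * exp (a k / \<mu>) \<le> exp_moment N r (\<lambda>j. a j / \<mu>)" if "r \<in> prob_simplex N" for r
      unfolding exp_moment_def using k prob_simplexD(1)[OF that]
      by (intro member_le_sum[of k _ "\<lambda>j. r j * exp (a j / \<mu>)"]) (auto simp: J_def)
    from this[OF L] this[OF R] have "w * exp (a k / \<mu>) \<le> worst_exp_moment N \<Gamma> (\<lambda>j. a j / \<mu>)"
      unfolding w_def worst_exp_moment_def by (auto simp: max_def)
    moreover have "0 < w * exp (a k / \<mu>)" using w by simp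
    ultimately have "ln (w * exp (a k / \<mu>)) \<le> ln (worst_exp_moment N \<Gamma> (\<lambda>j. a j / \<mu>))"
      by (subst ln_le_cancel_iff) auto
    then have "ln w + a k / \<mu> \<le> ln (worst_exp_moment N \<Gamma> (\<lambda>j. a j / \<mu>))"
      using w by (simp add: ln_mult)
    from mult_left_mono[OF this, of \<mu>] that show ?thesis by (simp add: distrib_left)
  qed
  have "((\<lambda>\<mu>. \<mu> * ln (worst_exp_moment N \<Gamma> (\<lambda>j. a j / \<mu>))) \<longlongrightarrow> a k) (at_right 0)"
  proof (rule tendsto_sandwich)
    show "\<forall>\<^sub>F \<mu> in at_right 0. \<mu> * ln w + a k \<le> \<mu> * ln (worst_exp_moment N \<Gamma> (\<lambda>j. a j / \<mu>))"
      using lower by (auto simp: eventually_at_right_field intro!: exI[of _ 1])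
    show "\<forall>\<^sub>F \<mu> in at_right 0. \<mu> * ln (worst_exp_moment N \<Gamma> (\<lambda>j. a j / \<mu>)) \<le> a k"
      using upper by (auto simp: eventually_at_right_field intro!: exI[of _ 1])
    have "((\<lambda>\<mu>. \<mu> * ln w + a k) \<longlongrightarrow> 0 * ln w + a k) (at_right 0)"
      by (intro tendsto_intros)
    then show "((\<lambda>\<mu>. \<mu> * ln w + a k) \<longlongrightarrow> a k) (at_right 0)" by simp
  qed simp
  then show ?thesis using k that by (auto simp: J_def)
qed

text \<open>The limit at \<open>0\<close> is the value of the objective at a point mass in each coordinate. The choice
\<open>\<theta> = 1 / 2\<close> puts every atom of either extremal distribution into the reference distribution, so this
point has finite entropy; this is what the case of a vanishing multiplier in the duality argument asks
for.\<close>
lemma dual_expr_tendsto: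
  fixes v :: "real ^ 'd::finite"
  assumes N: "1 \<le> N" "0 \<le> \<Gamma>" "\<Gamma> \<le> 1"
  obtains u t where "(u, t) \<in> entropy_epigraph N \<Gamma> h"
    "(dual_expr N \<Gamma> h \<epsilon> v \<longlongrightarrow> v \<bullet> u) (at_right 0)"
proof -
  have "\<exists>k. k \<le> N + 1 \<and> (0 < qL N \<Gamma> k \<or> 0 < qR N \<Gamma> k) \<and>
    ((\<lambda>\<mu>. \<mu> * ln (worst_exp_moment N \<Gamma> (\<lambda>j. v $ i * h i j / \<mu>))) \<longlongrightarrow> v $ i * h i k) (at_right 0)" for i
    using log_worst_exp_moment_tendsto[OF N, of "\<lambda>j. v $ i * h i j"] by metis
  then obtain k where k: "\<And>i. k i \<le> N + 1" "\<And>i. 0 < qL N \<Gamma> (k i) \<or> 0 < qR N \<Gamma> (k i)"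
    and lim: "\<And>i. ((\<lambda>\<mu>. \<mu> * ln (worst_exp_moment N \<Gamma> (\<lambda>j. v $ i * h i j / \<mu>))) \<longlongrightarrow> v $ i * h i (k i)) (at_right 0)"
    by metis
  define u where "u = (\<chi> i. h i (k i))"
  define q where "q i j = (if j = k i then 1 else 0 :: real)" for i j
  define t where "t = (\<Sum>i\<in>UNIV. rel_entropy_real N (q i) (mix_qLR N \<Gamma> (1 / 2)))"
  have s: "(\<Sum>j = 0..N + 1. f j * q i j) = f (k i)" for f :: "nat \<Rightarrow> real" and i
    using k(1)[of i] by (simp add: q_def if_distrib sum.delta cong: if_cong)
  have "(u, t) \<in> entropy_epigraph N \<Gamma> h"
  proof (rule entropy_epigraphI)
    show "q i \<in> prob_simplex N" for i
      using s[of "\<lambda>_. 1" i] by (simp add: prob_simplex_def q_def)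
    show "abs_cont N (q i) (mix_qLR N \<Gamma> (1/2))" for i
    proof -
      have "0 \<le> qL N \<Gamma> (k i)" "0 \<le> qR N \<Gamma> (k i)"
        using qL_nonneg[OF N] by (auto simp: qR_def)
      then have "0 < mix_qLR N \<Gamma> (1/2) (k i)"
        unfolding mix_qLR_def using k(2)[of i] by auto
      then show ?thesis by (auto simp: abs_cont_def q_def)
    qed
    show "(\<Sum>j = 0..N + 1. h i j * q i j) = u $ i" for i
      unfolding s by (simp add: u_def)
  qed (auto simp: t_def)
  moreover have "(dual_expr N \<Gamma> h \<epsilon> v \<longlongrightarrow> v \<bullet> u) (at_right 0)"
  proof -
    have "((\<lambda>\<mu>. \<mu> * ln (1 / \<epsilon>) + (\<Sum>i\<in>UNIV. \<mu> * ln (worst_exp_moment N \<Gamma> (\<lambda>j. v $ i * h i j / \<mu>)))) \<longlongrightarrow>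
       0 * ln (1 / \<epsilon>) + (\<Sum>i\<in>UNIV. v $ i * h i (k i))) (at_right 0)"
      by (intro tendsto_intros lim)
    then show ?thesis
      by (simp add: dual_expr_eq[abs_def] u_def inner_vec_def)
  qed
  ultimately show ?thesis using that by blast
qed

lemma dual_objective_ge:
  fixes v :: "real ^ 'd::finite"
  assumes N: "1 \<le> N" "0 \<le> \<Gamma>" "\<Gamma> \<le> 1" and u: "u \<in> U_indep N \<Gamma> h \<epsilon>" and mu: "0 \<le> \<mu>"
  shows "v \<bullet> u \<le> dual_objective N \<Gamma> h \<epsilon> v \<mu>"
proof -
  have pos: "v \<bullet> u \<le> dual_expr N \<Gamma> h \<epsilon> v \<mu>'" if "0 < \<mu>'" for \<mu>'
    using weak_duality[OF N u[unfolded mem_U_indep_iff] that] by (simp add: dual_expr_eq)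
  obtain u0 t where lim: "(dual_expr N \<Gamma> h \<epsilon> v \<longlongrightarrow> v \<bullet> u0) (at_right 0)"
    using dual_expr_tendsto[OF N] .
  have "v \<bullet> u \<le> v \<bullet> u0"
    by (rule tendsto_lowerbound[OF lim])
       (use pos in \<open>auto simp: eventually_at_right_field intro!: exI[of _ 1]\<close>)
  then show ?thesis
    using pos mu tendsto_Lim[OF _ lim] by (cases "\<mu> = 0") (auto simp: dual_objective_def)
qed

text \<open>Strong duality, for an arbitrary upper bound \<open>s\<close> instead of the supremum: a line separates the
attainable pairs (objective, entropy) from the quadrant of pairs whose objective exceeds \<open>s\<close> within
the entropy budget. Its slope is the multiplier \<open>\<mu>\<close>, and all attainable pairs satisfy
\<open>v \<bullet> u + \<mu> (L - t) \<le> s\<close> with \<open>L = ln (1 / \<epsilon>)\<close>. Maximizing the left-hand side gives the dual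
objective.\<close>
lemma dual_objective_le:
  fixes v :: "real ^ 'd::finite"
  assumes N: "1 \<le> N" "0 \<le> \<Gamma>" "\<Gamma> \<le> 1" and eps: "0 < \<epsilon>" "\<epsilon> < 1"
    and s: "\<And>u. u \<in> U_indep N \<Gamma> h \<epsilon> \<Longrightarrow> v \<bullet> u \<le> s"
  obtains \<mu> where "0 \<le> \<mu>" "dual_objective N \<Gamma> h \<epsilon> v \<mu> \<le> s"
proof -
  define L where "L = ln (1 / \<epsilon>)"
  have L: "0 < L" using eps by (simp add: L_def)
  define E where "E = entropy_epigraph N \<Gamma> h"
  define C where "C = (\<lambda>(u, t). (v \<bullet> u, t)) ` E"
  define K where "K = {s<..} \<times> {..L}"
  obtain u0 where u0: "\<And>t. 0 \<le> t \<Longrightarrow> (u0, t) \<in> E"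
    unfolding E_def using entropy_epigraph_slater[OF N, of h] by blast
  have "linear (\<lambda>(u, t::real). (v \<bullet> u, t))"
    by (intro linearI) (auto simp: inner_simps)
  then have "convex C"
    unfolding C_def E_def by (intro convex_linear_image convex_entropy_epigraph N)
  moreover have "convex K" unfolding K_def by (intro convex_Times) auto
  moreover have "C \<noteq> {}" using u0[of 0] by (auto simp: C_def)
  moreover have "K \<noteq> {}" using lt_ex gt_ex by (auto simp: K_def)
  moreover have "C \<inter> K = {}"
  proof -
    have "v \<bullet> u \<le> s" if "(u, t) \<in> E" "t \<le> L" for u t
    proof (rule s)
      show "u \<in> U_indep N \<Gamma> h \<epsilon>"
        using entropy_epigraph_mono[OF that[unfolded E_def]] by (simp add: mem_U_indep_iff L_def)
    qed
    then show ?thesis by (force simp: C_def K_def)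
  qed
  ultimately obtain a c where "a \<noteq> 0" and C: "\<And>x. x \<in> C \<Longrightarrow> a \<bullet> x \<le> c"
    and K: "\<And>x. x \<in> K \<Longrightarrow> c \<le> a \<bullet> x"
    using separating_hyperplane_sets[of C K] by metis
  obtain a1 a2 where a: "a = (a1, a2)" by fastforce
  have C': "a1 * (v \<bullet> u) + a2 * t \<le> c" if "(u, t) \<in> E" for u t
    using C[of "(v \<bullet> u, t)"] that by (force simp: C_def a)
  have K': "c \<le> a1 * x + a2 * L" if "s < x" for x
    using K[of "(x, L)"] that by (simp add: K_def a)
  \<comment> \<open>The attainable set is unbounded in the direction of larger entropy bounds.\<close>
  have a2: "a2 \<le> 0"
  proof (rule ccontr)
    assume "\<not> a2 \<le> 0"
    define t where "t = (\<bar>c - a1 * (v \<bullet> u0)\<bar> + 1) / a2"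
    have "0 \<le> t" using \<open>\<not> a2 \<le> 0\<close> by (simp add: t_def)
    from C'[OF u0[OF this]] show False
      using \<open>\<not> a2 \<le> 0\<close> by (simp add: t_def)
  qed
  have "v \<bullet> u0 \<le> s"
    using s[of u0] u0[of L] L by (simp add: mem_U_indep_iff E_def L_def)
  \<comment> \<open>With \<open>a1 = 0\<close> the line would separate the height \<open>0\<close> from \<open>L > 0\<close>; \<open>a1 < 0\<close> contradicts \<open>v \<bullet> u0 \<le> s\<close>.\<close>
  have a1: "0 < a1"
  proof (rule ccontr)
    assume "\<not> 0 < a1"
    then consider "a1 = 0" | "a1 < 0" by linarith
    then show False
    proof cases
      case 1
      then have "a2 \<noteq> 0" using \<open>a \<noteq> 0\<close> a by (simp add: zero_prod_def)
      then have "a2 * L < 0" using a2 L by (simp add: mult_less_0_iff)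
      then show False using K'[of "s + 1"] C'[OF u0[of 0]] 1 by simp
    next
      case 2
      have "c \<le> a1 * (s + 1)"
        using K'[of "s + 1"] a2 L mult_nonpos_nonneg[of a2 L] by simp
      also have "\<dots> < a1 * (v \<bullet> u0)" using 2 \<open>v \<bullet> u0 \<le> s\<close> by simp
      also have "\<dots> \<le> c" using C'[OF u0[of 0]] by simp
      finally show False by simp
    qed
  qed
  define \<mu> where "\<mu> = - a2 / a1"
  have mu: "0 \<le> \<mu>" using a1 a2 by (simp add: \<mu>_def divide_nonpos_pos)
  have a2_eq: "a2 = - (a1 * \<mu>)" using a1 by (simp add: \<mu>_def)
  have c: "c \<le> a1 * s + a2 * L"
  proof (rule field_le_epsilon)
    fix e :: real assume "0 < e"
    then show "c \<le> a1 * s + a2 * L + e"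
      using K'[of "s + e / a1"] a1 by (simp add: distrib_left)
  qed
  have lagr: "v \<bullet> u + \<mu> * L - \<mu> * t \<le> s" if "(u, t) \<in> E" for u t
  proof -
    have "a1 * (v \<bullet> u + \<mu> * L - \<mu> * t) \<le> a1 * s"
      using C'[OF that] c by (simp add: a2_eq algebra_simps)
    then show ?thesis using a1 by simp
  qed
  have "dual_objective N \<Gamma> h \<epsilon> v \<mu> \<le> s"
  proof (cases "\<mu> = 0")
    case True
    obtain u t where "(u, t) \<in> E" and lim: "(dual_expr N \<Gamma> h \<epsilon> v \<longlongrightarrow> v \<bullet> u) (at_right 0)"
      using dual_expr_tendsto[OF N, of h \<epsilon> v, folded E_def] .
    then show ?thesis
      using lagr True tendsto_Lim[OF _ lim] by (fastforce simp: dual_objective_def)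
  next
    case False
    then have "0 < \<mu>" using mu by simp
    from lagrangian_attained[OF N this, of h v, folded E_def] obtain u t where "(u, t) \<in> E"
      "v \<bullet> u = \<mu> * t + (\<Sum>i\<in>UNIV. \<mu> * ln (worst_exp_moment N \<Gamma> (\<lambda>j. v $ i * h i j / \<mu>)))"
      by blast
    then show ?thesis
      using lagr[of u t] False by (simp add: dual_objective_def dual_expr_eq L_def)
  qed
  then show ?thesis using that mu by blast
qed

lemma support_fun_U_indep:
  fixes v :: "real ^ 'd::finite"
  assumes N: "1 \<le> N" "0 \<le> \<Gamma>" "\<Gamma> \<le> 1" and eps: "0 < \<epsilon>" "\<epsilon> < 1"
  shows "support_fun v (U_indep N \<Gamma> h \<epsilon>) = (INF \<mu>\<in>{0..}. ereal (dual_objective N \<Gamma> h \<epsilon> v \<mu>))"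
proof (rule antisym)
  show "support_fun v (U_indep N \<Gamma> h \<epsilon>) \<le> (INF \<mu>\<in>{0..}. ereal (dual_objective N \<Gamma> h \<epsilon> v \<mu>))"
    unfolding support_fun_def
    by (intro SUP_least INF_greatest) (auto intro: dual_objective_ge[OF N])
  show "(INF \<mu>\<in>{0..}. ereal (dual_objective N \<Gamma> h \<epsilon> v \<mu>)) \<le> support_fun v (U_indep N \<Gamma> h \<epsilon>)"
  proof (rule ereal_le_real)
    fix s assume "support_fun v (U_indep N \<Gamma> h \<epsilon>) \<le> ereal s"
    then have "v \<bullet> u \<le> s" if "u \<in> U_indep N \<Gamma> h \<epsilon>" for u
      using that unfolding support_fun_def SUP_le_iff by auto
    then obtain \<mu> where "0 \<le> \<mu>" "dual_objective N \<Gamma> h \<epsilon> v \<mu> \<le> s"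
      using dual_objective_le[OF N eps] by metis
    then show "(INF \<mu>\<in>{0..}. ereal (dual_objective N \<Gamma> h \<epsilon> v \<mu>)) \<le> ereal s"
      by (intro INF_lower2[of \<mu>]) auto
  qed
qed

section \<open>Order statistics and the acceptance region of the test\<close>

lemma order_stat_mono:
  assumes "1 \<le> j" "j \<le> k" "k \<le> N"
  shows "order_stat N x j \<le> order_stat N x k"
  unfolding order_stat_def using assms by (intro sorted_nth_mono) auto

lemma order_stat_in_sample:
  assumes "1 \<le> j" "j \<le> N"
  obtains k where "k \<in> {1..N}" "order_stat N x j = x k"
proof -
  have "order_stat N x j \<in> set (sort (map x [1..<N + 1]))"
    unfolding order_stat_def using assms by (intro nth_mem) auto
  then have "order_stat N x j \<in> x ` {1..N}"
    by (simp add: atLeastLessThanSuc_atLeastAtMost del: upt_Suc)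
  then show ?thesis using that by blast
qed

lemma ext_order_stat_mono:
  assumes N: "1 \<le> N" and x: "\<And>k. k \<in> {1..N} \<Longrightarrow> lo \<le> x k \<and> x k \<le> hi"
    and "j \<le> k" "k \<le> N + 1"
  shows "ext_order_stat N lo hi x j \<le> ext_order_stat N lo hi x k"
proof -
  have "lo \<le> hi" using x[of 1] N by auto
  moreover have "lo \<le> order_stat N x i \<and> order_stat N x i \<le> hi" if "1 \<le> i" "i \<le> N" for i
    using order_stat_in_sample[OF that, of x] x by metis
  moreover have "order_stat N x j \<le> order_stat N x k" if "1 \<le> j" "k \<le> N"
    using that assms(3) by (intro order_stat_mono)
  ultimately show ?thesis
    using assms(3,4) by (auto simp: ext_order_stat_def)
qed

lemma ks_stat_le_iff:
  assumes "1 \<le> N"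
  shows "ks_stat N Q x \<le> \<Gamma> \<longleftrightarrow> (\<forall>j\<in>{1..N}.
    real j / real N - measure Q {..order_stat N x j} \<le> \<Gamma> \<and>
    measure Q {..<order_stat N x j} - (real j - 1) / real N \<le> \<Gamma>)"
  unfolding ks_stat_def using assms by (subst Max_le_iff) auto

section \<open>Moment bounds from stochastic dominance\<close>

text \<open>Replacing \<open>u\<close> by the next grid point above it only increases a monotone function; the sum on the right
telescopes to the value there.\<close>
lemma mono_le_staircase:
  fixes g :: "real \<Rightarrow> real" and y :: "nat \<Rightarrow> real"
  assumes g: "mono g" and y: "\<And>j. j < n \<Longrightarrow> y j \<le> y (Suc j)" and "u \<le> y n"
  shows "g u \<le> g (y 0) + (\<Sum>j<n. (g (y (Suc j)) - g (y j)) * indicator {y j<..} u)"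
  using y assms(3)
proof (induction n)
  case 0
  then show ?case using g by (simp add: monoD)
next
  case (Suc n)
  have step: "0 \<le> g (y (Suc n)) - g (y n)"
    using Suc.prems(1)[of n] g by (simp add: monoD)
  show ?case
  proof (cases "u \<le> y n")
    case True
    then have "g u \<le> g (y 0) + (\<Sum>j<n. (g (y (Suc j)) - g (y j)) * indicator {y j<..} u)"
      using Suc by simp
    also have "\<dots> \<le> g (y 0) + (\<Sum>j<Suc n. (g (y (Suc j)) - g (y j)) * indicator {y j<..} u)"
      using step by simp
    finally show ?thesis .
  next
    case False
    have "y j \<le> y n" if "j \<le> n" for j
      using that Suc.prems(1) by (induction n) (auto simp: le_Suc_eq intro: order_trans)
    then have "u \<in> {y j<..}" if "j < Suc n" for j
      using that False by (force simp: less_Suc_eq_le)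
    then have "(\<Sum>j<Suc n. (g (y (Suc j)) - g (y j)) * indicator {y j<..} u) =
       (\<Sum>j<Suc n. g (y (Suc j)) - g (y j))"
      by (intro sum.cong) auto
    also have "\<dots> = g (y (Suc n)) - g (y 0)"
      by (rule sum_lessThan_telescope)
    finally show ?thesis using Suc.prems(2) g by (simp add: monoD)
  qed
qed

text \<open>Summation by parts, which turns the expectation under \<open>p\<close> into a sum over the tails of \<open>p\<close>.\<close>
lemma weighted_sum_by_tails:
  fixes p G :: "nat \<Rightarrow> real"
  shows "(\<Sum>k = 0..n. p k * G k) =
    G 0 * (\<Sum>k = 0..n. p k) + (\<Sum>j<n. (G (Suc j) - G j) * (\<Sum>k = Suc j..n. p k))"
proof (induction n)
  case (Suc n)
  have "(\<Sum>j<n. (G (Suc j) - G j) * (\<Sum>k = Suc j..Suc n. p k)) =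
     (\<Sum>j<n. (G (Suc j) - G j) * (\<Sum>k = Suc j..n. p k)) + (\<Sum>j<n. G (Suc j) - G j) * p (Suc n)"
    unfolding sum_distrib_right sum.distrib[symmetric]
    by (intro sum.cong) (auto simp: distrib_left)
  then show ?case using Suc by (simp add: sum_lessThan_telescope algebra_simps)
qed simp

text \<open>Stochastic dominance: integrate the staircase bound, whose steps are nonnegative, and compare the tails
step by step.\<close>
lemma expectation_mono_le_of_tails:
  fixes Q :: "real measure" and p y :: "nat \<Rightarrow> real"
  assumes "prob_space Q" and sets: "sets Q = sets borel"
    and g: "mono g" "integrable Q g" and y: "\<And>j. j < n \<Longrightarrow> y j \<le> y (Suc j)"
    and top: "AE u in Q. u \<le> y n"
    and p: "(\<Sum>k = 0..n. p k) = 1"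
    and tail: "\<And>j. j < n \<Longrightarrow> measure Q {y j<..} \<le> (\<Sum>k = Suc j..n. p k)"
  shows "(\<integral>u. g u \<partial>Q) \<le> (\<Sum>k = 0..n. p k * g (y k))"
proof -
  interpret prob_space Q by fact
  define d where "d j = g (y (Suc j)) - g (y j)" for j
  have [measurable_cong]: "sets Q = sets borel" by fact
  have int: "integrable Q (\<lambda>u. d j * indicator {y j<..} u)" for j
    by (intro integrable_mult_right integrable_real_indicator) (auto simp: emeasure_eq_measure sets)
  have int': "integrable Q (\<lambda>u. \<Sum>j<n. d j * indicator {y j<..} u)"
    by (intro Bochner_Integration.integrable_sum int)
  have step: "(\<integral>u. d j * indicator {y j<..} u \<partial>Q) = d j * measure Q {y j<..}" for j
    by (simp add: sets_eq_imp_space_eq[OF sets])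
  have "(\<integral>u. g u \<partial>Q) \<le> (\<integral>u. g (y 0) + (\<Sum>j<n. d j * indicator {y j<..} u) \<partial>Q)"
  proof (rule integral_mono_AE)
    show "AE u in Q. g u \<le> g (y 0) + (\<Sum>j<n. d j * indicator {y j<..} u)"
      using top unfolding d_def by eventually_elim (intro mono_le_staircase g y)
    show "integrable Q (\<lambda>u. g (y 0) + (\<Sum>j<n. d j * indicator {y j<..} u))"
      by (intro Bochner_Integration.integrable_add int') simp
  qed fact
  also have "\<dots> = g (y 0) + (\<Sum>j<n. d j * measure Q {y j<..})"
    by (simp only: Bochner_Integration.integral_add[OF _ int'] integrable_const
        Bochner_Integration.integral_sum[OF int] step) (simp add: prob_space)
  also have "\<dots> \<le> g (y 0) + (\<Sum>j<n. d j * (\<Sum>k = Suc j..n. p k))"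
  proof -
    have "0 \<le> d j" if "j < n" for j
      using monoD[OF g(1) y[OF that]] by (simp add: d_def)
    then show ?thesis by (intro add_left_mono sum_mono mult_left_mono tail) auto
  qed
  also have "\<dots> = (\<Sum>k = 0..n. p k * g (y k))"
    unfolding weighted_sum_by_tails p d_def by simp
  finally show ?thesis .
qed

lemma qR_tail:
  assumes "1 \<le> N" "0 \<le> \<Gamma>" "\<Gamma> \<le> 1" "j \<le> N"
  shows "(\<Sum>k = Suc j..N + 1. qR N \<Gamma> k) = min 1 (\<Gamma> + (real N - real j) / real N)"
proof -
  have "(\<Sum>k = Suc j..N + 1. qR N \<Gamma> k) = (\<Sum>k = 0..N - j. qL N \<Gamma> k)"
    unfolding qR_def using assms(4)
    by (intro sum.reindex_bij_witness[of _ "\<lambda>k. N + 1 - k" "\<lambda>k. N + 1 - k"]) auto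
  then show ?thesis using assms by (simp add: qL_cumulative of_nat_diff)
qed

text \<open>The one-sided case. Only upper bounds on the tails occur, so the case of a negative exponent reduces to
it by the reflection \<open>u \<mapsto> - u\<close>, which exchanges the two extremal distributions.\<close>
lemma mgf_le_of_tails:
  fixes Q :: "real measure"
  assumes N: "1 \<le> N" "0 \<le> \<Gamma>" "\<Gamma> \<le> 1"
    and Q: "prob_space Q" "sets Q = sets borel" and c: "0 \<le> c" "integrable Q (\<lambda>u. exp (c * u))"
    and y: "\<And>j. j \<le> N \<Longrightarrow> y j \<le> y (Suc j)"
    and top: "AE u in Q. u \<le> y (N + 1)"
    and tail: "\<And>j. j \<in> {1..N} \<Longrightarrow> measure Q {y j<..} \<le> \<Gamma> + (real N - real j) / real N"
  shows "(\<integral>u. exp (c * u) \<partial>Q) \<le> exp_moment N (qR N \<Gamma>) (\<lambda>j. c * y j)"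
  unfolding exp_moment_def
proof (rule expectation_mono_le_of_tails[where g = "\<lambda>u. exp (c * u)"])
  show "mono (\<lambda>u. exp (c * u))" using c by (auto intro!: monoI mult_left_mono)
  show "(\<Sum>k = 0..N + 1. qR N \<Gamma> k) = 1" using prob_simplexD(2)[OF qR_simplex[OF N]] .
  show "measure Q {y j<..} \<le> (\<Sum>k = Suc j..N + 1. qR N \<Gamma> k)" if "j < N + 1" for j
  proof -
    have "measure Q {y j<..} \<le> 1" using Q(1) by (rule prob_space.prob_le_1)
    moreover have "measure Q {y j<..} \<le> \<Gamma> + (real N - real j) / real N" if "j = 0"
      using calculation that N by (simp add: add_increasing)
    ultimately show ?thesis
      using tail[of j] that qR_tail[OF N, of j] by (cases "j = 0") auto
  qed
qed (use y top c Q in auto)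

text \<open>This is all that the Chernoff argument uses of the sample: it separates the deterministic guarantee
from the statistical event.\<close>
definition mgf_dominated ::
  "nat \<Rightarrow> real \<Rightarrow> (nat \<Rightarrow> real) \<Rightarrow> real measure \<Rightarrow> bool" where
  "mgf_dominated N \<Gamma> y Q \<longleftrightarrow> (\<forall>c. integrable Q (\<lambda>u. exp (c * u)) \<and>
     (\<integral>u. exp (c * u) \<partial>Q) \<le> worst_exp_moment N \<Gamma> (\<lambda>j. c * y j))"

lemma mgf_dominated_if_ks_accepts:
  fixes Q :: "real measure"
  assumes N: "1 \<le> N" "0 \<le> \<Gamma>" "\<Gamma> \<le> 1"
    and Q: "prob_space Q" "sets Q = sets borel" and box: "AE u in Q. lo \<le> u \<and> u \<le> hi"
    and x: "\<And>k. k \<in> {1..N} \<Longrightarrow> lo \<le> x k \<and> x k \<le> hi"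
    and ks: "ks_stat N Q x \<le> \<Gamma>"
  shows "mgf_dominated N \<Gamma> (ext_order_stat N lo hi x) Q"
  unfolding mgf_dominated_def
proof (intro allI conjI)
  fix c :: real
  interpret prob_space Q by fact
  have [measurable_cong]: "sets Q = sets borel" by fact
  have space: "space Q = UNIV" using sets_eq_imp_space_eq[OF Q(2)] by simp
  define y where "y = ext_order_stat N lo hi x"
  have ymono: "y j \<le> y k" if "j \<le> k" "k \<le> N + 1" for j k
    unfolding y_def using that N x by (intro ext_order_stat_mono)
  show int: "integrable Q (\<lambda>u. exp (c * u))"
  proof (rule integrable_const_bound[of _ "exp (\<bar>c\<bar> * max \<bar>lo\<bar> \<bar>hi\<bar>)"])
    show "AE u in Q. norm (exp (c * u)) \<le> exp (\<bar>c\<bar> * max \<bar>lo\<bar> \<bar>hi\<bar>)"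
      using box
    proof eventually_elim
      case (elim u)
      then have "\<bar>u\<bar> \<le> max \<bar>lo\<bar> \<bar>hi\<bar>" by auto
      then have "\<bar>c * u\<bar> \<le> \<bar>c\<bar> * max \<bar>lo\<bar> \<bar>hi\<bar>" by (simp add: abs_mult mult_left_mono)
      then show ?case by simp
    qed
  qed measurable
  have ks': "real j / real N - measure Q {..y j} \<le> \<Gamma>"
      "measure Q {..<y j} - (real j - 1) / real N \<le> \<Gamma>" if "j \<in> {1..N}" for j
    using ks[unfolded ks_stat_le_iff[OF N(1)]] that by (auto simp: y_def ext_order_stat_def)
  show "(\<integral>u. exp (c * u) \<partial>Q) \<le> worst_exp_moment N \<Gamma> (\<lambda>j. c * ext_order_stat N lo hi x j)"
  proof (cases "0 \<le> c")
    case True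
    have "(\<integral>u. exp (c * u) \<partial>Q) \<le> exp_moment N (qR N \<Gamma>) (\<lambda>j. c * y j)"
    proof (rule mgf_le_of_tails[OF N Q True int])
      show "AE u in Q. u \<le> y (N + 1)" using box by (auto simp: y_def ext_order_stat_def)
      fix j assume j: "j \<in> {1..N}"
      have "measure Q {y j<..} = 1 - measure Q {..y j}"
        using prob_compl[of "{..y j}"] by (simp add: space Q(2) Compl_eq_Diff_UNIV[symmetric] Compl_atMost)
      then show "measure Q {y j<..} \<le> \<Gamma> + (real N - real j) / real N"
        using ks'(1)[OF j] N(1) by (simp add: diff_divide_distrib)
    qed (use ymono in auto)
    then show ?thesis by (simp add: worst_exp_moment_def y_def)
  next
    case False
    define Q' where "Q' = distr Q borel uminus"
    define y' where "y' j = - y (N + 1 - j)" for j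
    have "(\<integral>u. exp (- c * u) \<partial>Q') \<le> exp_moment N (qR N \<Gamma>) (\<lambda>j. - c * y' j)"
    proof (rule mgf_le_of_tails[OF N])
      show "prob_space Q'" unfolding Q'_def by (rule prob_space_distr) measurable
      show "integrable Q' (\<lambda>u. exp (- c * u))"
        unfolding Q'_def using int by (subst integrable_distr_eq) auto
      show "AE u in Q'. u \<le> y' (N + 1)"
        unfolding Q'_def using box
        by (subst AE_distr_iff) (auto simp: y'_def y_def ext_order_stat_def)
      fix j assume j: "j \<in> {1..N}"
      have "measure Q' {y' j<..} = measure Q {..<y (N + 1 - j)}"
        unfolding Q'_def by (subst measure_distr)
          (auto simp: space y'_def intro!: arg_cong[of _ _ "measure Q"])
      also have "\<dots> \<le> \<Gamma> + (real (N + 1 - j) - 1) / real N"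
      proof -
        have "N + 1 - j \<in> {1..N}" using j by auto
        from ks'(2)[OF this] show ?thesis by linarith
      qed
      also have "real (N + 1 - j) - 1 = real N - real j" using j by (simp add: of_nat_diff)
      finally show "measure Q' {y' j<..} \<le> \<Gamma> + (real N - real j) / real N" .
    qed (use False ymono in \<open>auto simp: Q'_def y'_def Suc_diff_le\<close>)
    also have "(\<integral>u. exp (- c * u) \<partial>Q') = (\<integral>u. exp (c * u) \<partial>Q)"
      unfolding Q'_def by (subst integral_distr) auto
    also have "exp_moment N (qR N \<Gamma>) (\<lambda>j. - c * y' j) = exp_moment N (qL N \<Gamma>) (\<lambda>j. c * y j)"
      unfolding exp_moment_def y'_def sum_qR by (intro sum.cong) auto
    finally show ?thesis by (simp add: worst_exp_moment_def y_def)
  qed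
qed

section \<open>The probabilistic guarantee\<close>

text \<open>The complement of the support is a union of open null sets. In a second countable space a countable
subfamily has the same union, so it is a null set.\<close>
lemma AE_in_superset_of_support:
  fixes P :: "'a::second_countable_topology measure"
  assumes "prob_space P" "sets P = sets borel" "measure_support P \<subseteq> B"
  shows "AE u in P. u \<in> B"
proof -
  interpret prob_space P by fact
  define F where "F = uminus ` {C. closed C \<and> measure P C = 1}"
  obtain F' where F': "F' \<subseteq> F" "countable F'" "\<Union>F' = \<Union>F"
    by (rule Lindelof[of F]) (auto simp: F_def)
  have "AE u in P. u \<notin> V" if "V \<in> F" for V
  proof -
    obtain C where C: "V = - C" "closed C" "measure P C = 1" using \<open>V \<in> F\<close> by (auto simp: F_def)
    then have "AE u in P. u \<in> C"
      using assms(2) by (subst (asm) prob_eq_1) auto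
    then show ?thesis using C by auto
  qed
  then have "AE u in P. \<forall>V\<in>F'. u \<notin> V"
    using F' by (subst AE_ball_countable) auto
  then show ?thesis
  proof eventually_elim
    case (elim u)
    then have "u \<notin> \<Union>F" using F'(3) by blast
    then have "u \<in> measure_support P" by (auto simp: F_def measure_support_def)
    then show ?case using assms(3) by blast
  qed
qed

lemma chernoff_bound:
  fixes P :: "(real ^ 'd::finite) measure" and v :: "real ^ 'd"
  assumes P: "prob_space P" "sets P = sets borel"
    and indep: "prob_space.indep_vars P (\<lambda>_. borel) (\<lambda>i u. u $ i) UNIV"
    and mgf: "\<And>i. mgf_dominated N \<Gamma> (h i) (distr P borel (\<lambda>u. u $ i))"
    and N: "1 \<le> N" "0 \<le> \<Gamma>" "\<Gamma> \<le> 1" and eps: "0 < \<epsilon>" and mu: "0 < \<mu>"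
  shows "measure P {u \<in> space P. c \<le> v \<bullet> u} \<le> \<epsilon> * exp ((dual_expr N \<Gamma> h \<epsilon> v \<mu> - c) / \<mu>)"
proof -
  interpret prob_space P by fact
  have [measurable_cong]: "sets P = sets borel" by fact
  define W where "W i = worst_exp_moment N \<Gamma> (\<lambda>j. v $ i * h i j / \<mu>)" for i
  define Y where "Y i u = exp (v $ i / \<mu> * (u $ i))" for i and u :: "real ^ 'd"
  have prod: "exp (v \<bullet> u / \<mu>) = (\<Prod>i\<in>UNIV. Y i u)" for u
    by (simp add: Y_def inner_vec_def sum_divide_distrib exp_sum[symmetric])
  have indep_Y: "indep_vars (\<lambda>_. borel) Y UNIV"
    unfolding Y_def by (rule indep_vars_compose2[OF indep]) measurable
  have int_Y: "integrable P (Y i)" for i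
  proof -
    have "integrable (distr P borel (\<lambda>u. u $ i)) (\<lambda>x. exp (v $ i / \<mu> * x))"
      using mgf[of i] unfolding mgf_dominated_def by blast
    then show ?thesis
      by (subst (asm) integrable_distr_eq) (simp_all add: Y_def[abs_def])
  qed
  have le_Y: "(\<integral>u. Y i u \<partial>P) \<le> W i" for i
  proof -
    have "(\<integral>u. Y i u \<partial>P) = (\<integral>x. exp (v $ i / \<mu> * x) \<partial>distr P borel (\<lambda>u. u $ i))"
      unfolding Y_def by (subst integral_distr) auto
    also have "\<dots> \<le> W i"
    proof -
      have "(\<integral>x. exp (v $ i / \<mu> * x) \<partial>distr P borel (\<lambda>u. u $ i)) \<le>
          worst_exp_moment N \<Gamma> (\<lambda>j. v $ i / \<mu> * h i j)"
        using mgf[of i] unfolding mgf_dominated_def by blast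
      then show ?thesis by (simp add: W_def)
    qed
    finally show ?thesis .
  qed
  have nonneg_Y: "0 \<le> (\<integral>u. Y i u \<partial>P)" for i
    by (rule Bochner_Integration.integral_nonneg) (simp add: Y_def)
  have pos_W: "0 < W i" for i
    unfolding W_def worst_exp_moment_def
    using exp_moment_pos[OF qL_simplex[OF N]] by (simp add: less_max_iff_disj)
  have int: "integrable P (\<lambda>u. exp (v \<bullet> u / \<mu>))"
    unfolding prod by (intro indep_vars_integrable indep_Y int_Y) auto
  have "{u \<in> space P. c \<le> v \<bullet> u} = {u \<in> space P. exp (c / \<mu>) \<le> exp (v \<bullet> u / \<mu>)}"
    using mu by (simp add: divide_le_cancel)
  then have "measure P {u \<in> space P. c \<le> v \<bullet> u} \<le> (\<integral>u. exp (v \<bullet> u / \<mu>) \<partial>P) / exp (c / \<mu>)"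
    using integral_Markov_inequality_measure[OF int, of "{}" "exp (c / \<mu>)"] by simp
  also have "(\<integral>u. exp (v \<bullet> u / \<mu>) \<partial>P) = (\<Prod>i\<in>UNIV. \<integral>u. Y i u \<partial>P)"
    unfolding prod by (intro indep_vars_lebesgue_integral indep_Y int_Y) auto
  also have "\<dots> \<le> (\<Prod>i\<in>UNIV. W i)"
    using nonneg_Y le_Y by (intro prod_mono) auto
  also have "(\<Prod>i\<in>UNIV. W i) = exp (\<Sum>i\<in>UNIV. ln (W i))"
    using pos_W by (simp add: exp_sum)
  also have "exp (\<Sum>i\<in>UNIV. ln (W i)) / exp (c / \<mu>) =
      \<epsilon> * exp ((dual_expr N \<Gamma> h \<epsilon> v \<mu> - c) / \<mu>)"
  proof -
    have "(dual_expr N \<Gamma> h \<epsilon> v \<mu> - c) / \<mu> = ln (1 / \<epsilon>) + (\<Sum>i\<in>UNIV. ln (W i)) - c / \<mu>"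
      using mu unfolding dual_expr_eq W_def[symmetric]
      by (simp add: diff_divide_distrib add_divide_distrib sum_divide_distrib)
    then show ?thesis using eps by (simp add: exp_add exp_diff)
  qed
  finally show ?thesis by (simp add: divide_right_mono)
qed

text \<open>A multiplier with dual objective at most \<open>s\<close> may be \<open>0\<close>, where the objective is only a limit and no
Chernoff bound exists. For each \<open>c > s\<close>, however, some positive multiplier has dual expression at most
\<open>c\<close>, and the Chernoff bound at \<open>c\<close> is then at most \<open>\<epsilon>\<close>. Letting \<open>c\<close> decrease to \<open>s\<close> gives the strict
half-space.\<close>
lemma prob_above_support_fun_le:
  fixes P :: "(real ^ 'd::finite) measure" and v :: "real ^ 'd"
  assumes P: "prob_space P" "sets P = sets borel"
    and indep: "prob_space.indep_vars P (\<lambda>_. borel) (\<lambda>i u. u $ i) UNIV"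
    and mgf: "\<And>i. mgf_dominated N \<Gamma> (h i) (distr P borel (\<lambda>u. u $ i))"
    and N: "1 \<le> N" "0 \<le> \<Gamma>" "\<Gamma> \<le> 1" and eps: "0 < \<epsilon>" "\<epsilon> < 1"
    and s: "\<And>u. u \<in> U_indep N \<Gamma> h \<epsilon> \<Longrightarrow> v \<bullet> u \<le> s"
  shows "measure P {u \<in> space P. s < v \<bullet> u} \<le> \<epsilon>"
proof -
  interpret prob_space P by fact
  have [measurable_cong]: "sets P = sets borel" by fact
  obtain \<mu> where mu: "0 \<le> \<mu>" "dual_objective N \<Gamma> h \<epsilon> v \<mu> \<le> s"
    using dual_objective_le[OF N eps s] by metis
  have le: "measure P {u \<in> space P. c \<le> v \<bullet> u} \<le> \<epsilon>" if "s < c" for c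
  proof -
    obtain \<mu>' where mu': "0 < \<mu>'" "dual_expr N \<Gamma> h \<epsilon> v \<mu>' \<le> c"
    proof (cases "\<mu> = 0")
      case True
      obtain u t where lim: "(dual_expr N \<Gamma> h \<epsilon> v \<longlongrightarrow> v \<bullet> u) (at_right 0)"
        using dual_expr_tendsto[OF N, of h \<epsilon> v] .
      have "v \<bullet> u < c"
        using mu(2) True tendsto_Lim[OF _ lim] \<open>s < c\<close> by (simp add: dual_objective_def)
      from order_tendstoD(2)[OF lim this] obtain b where b: "0 < b"
        "\<And>y. 0 < y \<Longrightarrow> y < b \<Longrightarrow> dual_expr N \<Gamma> h \<epsilon> v y < c"
        by (auto simp: eventually_at_right_field)
      show ?thesis
        by (rule that[of "b / 2"]) (use b(1) less_imp_le[OF b(2)[of "b / 2"]] in auto)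
    next
      case False
      then show ?thesis using that[of \<mu>] mu \<open>s < c\<close> by (simp add: dual_objective_def)
    qed
    have "measure P {u \<in> space P. c \<le> v \<bullet> u} \<le> \<epsilon> * exp ((dual_expr N \<Gamma> h \<epsilon> v \<mu>' - c) / \<mu>')"
      by (rule chernoff_bound[OF P indep mgf N eps(1) mu'(1)])
    also have "\<dots> \<le> \<epsilon> * 1"
      using mu' eps by (intro mult_left_mono) (auto simp: divide_nonpos_pos)
    finally show ?thesis by simp
  qed
  define A where "A n = {u \<in> space P. s + 1 / real (Suc n) \<le> v \<bullet> u}" for n
  have "incseq A"
    unfolding A_def incseq_Suc_iff by (auto intro: order_trans[rotated] simp: frac_le)
  moreover have "range A \<subseteq> sets P" unfolding A_def by auto
  ultimately have "(\<lambda>n. measure P (A n)) \<longlonglongrightarrow> measure P (\<Union>n. A n)"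
    by (intro finite_Lim_measure_incseq)
  moreover have "(\<Union>n. A n) = {u \<in> space P. s < v \<bullet> u}"
  proof safe
    fix u assume "u \<in> space P" "s < v \<bullet> u"
    then obtain n where "1 / real (Suc n) < v \<bullet> u - s"
      using nat_approx_posE[of "v \<bullet> u - s"] by auto
    then show "u \<in> (\<Union>n. A n)" using \<open>u \<in> space P\<close> by (auto simp: A_def intro!: exI[of _ n])
  next
    fix u n assume "u \<in> A n"
    then have "s + 1 / real (Suc n) \<le> v \<bullet> u" by (simp add: A_def)
    moreover have "0 < 1 / real (Suc n)" by simp
    ultimately show "s < v \<bullet> u" by linarith
  qed (auto simp: A_def)
  ultimately show ?thesis
    using le by (intro LIMSEQ_le_const2[of _ "measure P {u \<in> space P. s < v \<bullet> u}"]) (auto simp: A_def)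
qed

lemma U_indep_implies_guarantee:
  fixes P :: "(real ^ 'd::finite) measure"
  assumes P: "prob_space P" "sets P = sets borel"
    and indep: "prob_space.indep_vars P (\<lambda>_. borel) (\<lambda>i u. u $ i) UNIV"
    and mgf: "\<And>i. mgf_dominated N \<Gamma> (h i) (distr P borel (\<lambda>u. u $ i))"
    and N: "1 \<le> N" "0 \<le> \<Gamma>" "\<Gamma> \<le> 1"
  shows "simultaneously_implies_guarantee k P (U_indep N \<Gamma> h)"
  unfolding simultaneously_implies_guarantee_def implies_guarantee_def
proof (intro allI impI, elim conjE)
  fix \<epsilon> x' and f :: "real ^ 'd \<Rightarrow> real ^ 'k \<Rightarrow> real"
  assume eps: "0 < \<epsilon>" "\<epsilon> < 1" and conc: "\<forall>x. concave_on UNIV (\<lambda>u. f u x)"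
    and f: "\<forall>u\<in>U_indep N \<Gamma> h \<epsilon>. f u x' \<le> 0"
  interpret prob_space P by fact
  have [measurable_cong]: "sets P = sets borel" by fact
  have space: "space P = UNIV" using sets_eq_imp_space_eq[OF P(2)] by simp
  define U where "U = U_indep N \<Gamma> h \<epsilon>"
  define V where "V = {u. 0 < f u x'}"
  have "continuous_on UNIV (\<lambda>u. - f u x')"
    using conc by (intro convex_on_continuous) (auto simp: concave_on_def)
  then have cont: "continuous_on UNIV (\<lambda>u. f u x')"
    using continuous_on_minus by fastforce
  have "open V"
    unfolding V_def by (intro open_Collect_less continuous_on_const cont)
  have "convex V"
  proof (rule convexI)
    fix u u' :: "real ^ 'd" and a b :: real
    assume u: "u \<in> V" "u' \<in> V" and ab: "0 \<le> a" "0 \<le> b" "a + b = 1"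
    have "a * f u x' + b * f u' x' \<le> f (a *\<^sub>R u + b *\<^sub>R u') x'"
      using conc ab unfolding concave_on_iff by blast
    moreover have "0 < a * f u x' + b * f u' x'"
      using u ab unfolding V_def by (cases "a = 0") (auto intro: add_pos_nonneg)
    ultimately show "a *\<^sub>R u + b *\<^sub>R u' \<in> V" by (simp add: V_def)
  qed
  have "measure P V \<le> \<epsilon>"
  proof (cases "V = {}")
    case True
    then show ?thesis using eps by simp
  next
    case False
    have "convex U" unfolding U_def by (rule convex_U_indep[OF N])
    moreover have "U \<noteq> {}"
    proof -
      obtain u where "\<And>t. 0 \<le> t \<Longrightarrow> (u, t) \<in> entropy_epigraph N \<Gamma> h"
        using entropy_epigraph_slater[OF N, of h] by blast
      from this[of "ln (1 / \<epsilon>)"] eps show ?thesis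
        unfolding U_def by (auto simp: mem_U_indep_iff[symmetric])
    qed
    moreover have "U \<inter> V = {}" using f by (force simp: U_def V_def)
    ultimately obtain v b where v: "v \<noteq> 0" and U: "\<And>u. u \<in> U \<Longrightarrow> v \<bullet> u \<le> b"
      and V: "\<And>u. u \<in> V \<Longrightarrow> b \<le> v \<bullet> u"
      using separating_hyperplane_sets[of U V] \<open>convex V\<close> False by metis
    have "b < v \<bullet> u" if "u \<in> V" for u
    proof -
      obtain e where e: "0 < e" "cball u e \<subseteq> V"
        using \<open>open V\<close> \<open>u \<in> V\<close> unfolding open_contains_cball by blast
      \<comment> \<open>Openness makes the separation strict: step back against \<open>v\<close> within \<open>V\<close>.\<close>
      define w where "w = u - (e / norm v) *\<^sub>R v"
      have "w \<in> V"
        using e v by (intro subsetD[OF e(2)]) (simp add: w_def dist_norm)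
      then have "b \<le> v \<bullet> u - e / norm v * (v \<bullet> v)"
        using V[OF \<open>w \<in> V\<close>] unfolding w_def by (simp add: inner_diff_right)
      moreover have "0 < e / norm v * (v \<bullet> v)" using e v by simp
      ultimately show ?thesis by linarith
    qed
    then have "measure P V \<le> measure P {u \<in> space P. b < v \<bullet> u}"
      by (intro finite_measure_mono) (auto simp: space)
    also have "\<dots> \<le> \<epsilon>"
      by (rule prob_above_support_fun_le[OF P indep mgf N eps]) (use U in \<open>simp add: U_def\<close>)
    finally show ?thesis .
  qed
  moreover have "{u \<in> space P. f u x' \<le> 0} = space P - V" by (auto simp: V_def)
  moreover have "V \<in> events" using \<open>open V\<close> by (simp add: P(2))
  ultimately show "1 - \<epsilon> \<le> measure P {u \<in> space P. f u x' \<le> 0}"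
    using prob_compl[of V] by simp
qed

section \<open>Measurability of the acceptance region\<close>

lemma sorted_nth_le_iff:
  fixes t :: "'a::linorder"
  assumes "sorted xs" "i < length xs"
  shows "xs ! i \<le> t \<longleftrightarrow> i < length (filter (\<lambda>y. y \<le> t) xs)"
  using assms
proof (induction xs arbitrary: i)
  case (Cons a xs)
  show ?case
  proof (cases "a \<le> t")
    case True
    then show ?thesis using Cons by (cases i) auto
  next
    case False
    then have "\<forall>y\<in>set (a # xs). \<not> y \<le> t" using Cons.prems(1) by auto
    then have "filter (\<lambda>y. y \<le> t) (a # xs) = []" "\<not> (a # xs) ! i \<le> t"
      using Cons.prems(2) nth_mem by (blast intro: filter_False, blast)
    then show ?thesis by simp
  qed
qed simp

text \<open>Sorting is awkward for measurability proofs; counting the samples below a level is a sum of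
indicators.\<close>
lemma order_stat_le_iff:
  assumes "1 \<le> j" "j \<le> N"
  shows "order_stat N x j \<le> t \<longleftrightarrow> real j \<le> (\<Sum>k\<in>{1..N}. indicator {..t} (x k))"
proof -
  define ys where "ys = map x [1..<N + 1]"
  have "order_stat N x j \<le> t \<longleftrightarrow> j - 1 < length (filter (\<lambda>y. y \<le> t) (sort ys))"
    unfolding order_stat_def ys_def using assms by (intro sorted_nth_le_iff) auto
  also have "length (filter (\<lambda>y. y \<le> t) (sort ys)) = length (filter (\<lambda>y. y \<le> t) ys)"
    by (simp add: filter_sort)
  also have "\<dots> = length (filter (\<lambda>k. x k \<le> t) [1..<N + 1])"
    by (simp add: ys_def filter_map comp_def del: upt_Suc)
  also have "\<dots> = card ({k. x k \<le> t} \<inter> set [1..<N + 1])"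
    by (intro distinct_length_filter) simp
  also have "{k. x k \<le> t} \<inter> set [1..<N + 1] = {k \<in> {1..N}. x k \<le> t}" by auto
  also have "j - 1 < card {k \<in> {1..N}. x k \<le> t} \<longleftrightarrow> real j \<le> real (card {k \<in> {1..N}. x k \<le> t})"
    using assms by linarith
  also have "real (card {k \<in> {1..N}. x k \<le> t}) = (\<Sum>k\<in>{1..N}. indicator {..t} (x k))"
    by (simp add: indicator_def sum.If_cases Int_def conj_commute)
  finally show ?thesis .
qed

lemma measurable_order_stat:
  assumes "1 \<le> j" "j \<le> N"
  shows "(\<lambda>x. order_stat N x j) \<in> borel_measurable (Pi\<^sub>M {1..N} (\<lambda>_. borel))"
proof (rule borel_measurableI_le)
  fix t :: real
  have "(\<lambda>x. \<Sum>k\<in>{1..N}. indicator {..t} (x k) :: real)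
      \<in> borel_measurable (Pi\<^sub>M {1..N} (\<lambda>_. borel))"
    by (intro borel_measurable_sum) measurable
  then show "{x \<in> space (Pi\<^sub>M {1..N} (\<lambda>_. borel)). order_stat N x j \<le> t}
      \<in> sets (Pi\<^sub>M {1..N} (\<lambda>_. borel))"
    unfolding order_stat_le_iff[OF assms] by measurable
qed

lemma ks_accept_measurable:
  assumes N: "1 \<le> N" and Q: "prob_space Q" "sets Q = sets borel"
  shows "{x \<in> space (Pi\<^sub>M {1..N} (\<lambda>_. borel)). ks_stat N Q x \<le> \<Gamma>} \<in> sets (Pi\<^sub>M {1..N} (\<lambda>_. borel))"
proof -
  interpret prob_space Q by fact
  have [measurable]: "(\<lambda>t. measure Q {..t}) \<in> borel_measurable borel"
    by (rule borel_measurable_mono, rule monoI, rule finite_measure_mono) (auto simp: Q(2))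
  have [measurable]: "(\<lambda>t. measure Q {..<t}) \<in> borel_measurable borel"
    by (rule borel_measurable_mono, rule monoI, rule finite_measure_mono) (auto simp: Q(2))
  have [measurable]: "(\<lambda>x. order_stat N x j) \<in> borel_measurable (Pi\<^sub>M {1..N} (\<lambda>_. borel))"
    if "j \<in> {1..N}" for j using that by (intro measurable_order_stat) auto
  have "{x \<in> space (Pi\<^sub>M {1..N} (\<lambda>_. borel)).
      real j / real N - measure Q {..order_stat N x j} \<le> \<Gamma> \<and>
      measure Q {..<order_stat N x j} - (real j - 1) / real N \<le> \<Gamma>} \<in> sets (Pi\<^sub>M {1..N} (\<lambda>_. borel))"
    if [simp]: "j \<in> {1..N}" for j
    using that by measurable
  then show ?thesis
    unfolding ks_stat_le_iff[OF N] by (intro sets.sets_Collect_finite_All) auto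
qed

lemma ks_accept_prob:
  assumes N: "1 \<le> N" and Q: "prob_space Q" "sets Q = sets borel" and ks: "ks_threshold N a \<Gamma>"
  shows "1 - a \<le> measure (Pi\<^sub>M {1..N} (\<lambda>_. Q))
    {x \<in> space (Pi\<^sub>M {1..N} (\<lambda>_. borel)). ks_stat N Q x \<le> \<Gamma>}"
proof -
  interpret PQ: prob_space "Pi\<^sub>M {1..N} (\<lambda>_. Q)"
    by (rule prob_space_PiM) (rule Q(1))
  have sets_eq: "sets (Pi\<^sub>M {1..N} (\<lambda>_. Q)) = sets (Pi\<^sub>M {1..N} (\<lambda>_. borel))"
    using Q(2) by (intro sets_PiM_cong) auto
  note space_eq = sets_eq_imp_space_eq[OF sets_eq]
  define A where "A = {x \<in> space (Pi\<^sub>M {1..N} (\<lambda>_. borel)). ks_stat N Q x \<le> \<Gamma>}"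
  have A: "A \<in> sets (Pi\<^sub>M {1..N} (\<lambda>_. Q))"
    unfolding A_def sets_eq by (rule ks_accept_measurable[OF N Q])
  have "measure (Pi\<^sub>M {1..N} (\<lambda>_. Q)) (space (Pi\<^sub>M {1..N} (\<lambda>_. Q)) - A) \<le> a"
  proof -
    have "space (Pi\<^sub>M {1..N} (\<lambda>_. Q)) - A =
        {x \<in> space (Pi\<^sub>M {1..N} (\<lambda>_. Q)). ks_stat N Q x > \<Gamma>}"
      unfolding A_def space_eq by auto
    then show ?thesis using ks Q unfolding ks_threshold_def by metis
  qed
  moreover have "measure (Pi\<^sub>M {1..N} (\<lambda>_. Q)) (space (Pi\<^sub>M {1..N} (\<lambda>_. Q)) - A) =
      1 - measure (Pi\<^sub>M {1..N} (\<lambda>_. Q)) A"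
    by (rule PQ.prob_compl[OF A])
  ultimately show ?thesis by (simp add: A_def)
qed

lemma ks_stat_cong:
  assumes "\<And>k. k \<in> {1..N} \<Longrightarrow> x k = y k"
  shows "ks_stat N Q x = ks_stat N Q y"
proof -
  have "map x [1..<N + 1] = map y [1..<N + 1]"
    using assms by (intro map_cong) auto
  then show ?thesis unfolding ks_stat_def order_stat_def by (simp only:)
qed

section \<open>Independence of the coordinate samples\<close>

context prob_space
begin

text \<open>The scalars \<open>X k \<omega> $ i\<close> are jointly independent: factor the probability first over the samples \<open>k\<close>, then,
within one sample, over the coordinates \<open>i\<close>. Grouping the scalars by \<open>i\<close> instead of \<open>k\<close> afterwards gives
the independence of the \<open>d\<close> coordinate samples.\<close>
lemma indep_vars_sample_components:
  fixes X :: "nat \<Rightarrow> 'a \<Rightarrow> real ^ 'd::finite"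
  assumes N: "1 \<le> N" and P: "prob_space P"
    and indep: "prob_space.indep_vars P (\<lambda>_. borel) (\<lambda>i u. u $ i) UNIV"
    and X: "indep_vars (\<lambda>_. borel) X {1..N}"
    and distr: "\<And>j. j \<in> {1..N} \<Longrightarrow> distr M borel (X j) = P"
  shows "indep_vars (\<lambda>_. borel) (\<lambda>(k, i) \<omega>. X k \<omega> $ i) ({1..N} \<times> UNIV)"
proof -
  have X_meas [measurable]: "X k \<in> borel_measurable M" if "k \<in> {1..N}" for k
    using X that by (auto simp: indep_vars_def)
  have comp_meas: "random_variable borel (\<lambda>\<omega>. X k \<omega> $ i)" if "k \<in> {1..N}" for k i
    by (rule measurable_compose[OF X_meas[OF that]]) measurable
  define Y where "Y = (\<lambda>(k, i) \<omega>. X k \<omega> $ i)"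
  show ?thesis
    unfolding Y_def[symmetric]
  proof (subst indep_vars_finite[where E = "\<lambda>_. sets borel"])
    show "\<forall>A\<in>Pi ({1..N} \<times> UNIV) (\<lambda>_. sets borel).
      prob (\<Inter>j\<in>{1..N} \<times> UNIV. Y j -` A j \<inter> space M) =
      (\<Prod>j\<in>{1..N} \<times> UNIV. prob (Y j -` A j \<inter> space M))"
    proof
      fix A :: "nat \<times> 'd \<Rightarrow> real set" assume "A \<in> Pi ({1..N} \<times> UNIV) (\<lambda>_. sets borel)"
      then have A [measurable]: "A (k, i) \<in> sets borel" if "k \<in> {1..N}" for k i using that by auto
      define B where "B k = {u :: real ^ 'd. \<forall>i. u $ i \<in> A (k, i)}" for k
      have proj [measurable]: "(\<lambda>u :: real ^ 'd. u $ i) \<in> borel_measurable borel" for i by measurable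
      have B: "B k \<in> sets borel" if "k \<in> {1..N}" for k
      proof -
        have "B k = (\<Inter>i. (\<lambda>u. u $ i) -` A (k, i) \<inter> space borel)" by (auto simp: B_def)
        also have "\<dots> \<in> sets borel"
          by (intro sets.finite_INT measurable_sets[OF proj A[OF that]]) auto
        finally show ?thesis .
      qed
      have PB: "prob (X k -` B k \<inter> space M) = (\<Prod>i\<in>UNIV. prob (Y (k, i) -` A (k, i) \<inter> space M))"
        if k: "k \<in> {1..N}" for k
      proof -
        have sP: "sets P = sets borel" "space P = UNIV"
          using distr[OF k] by (metis sets_distr, metis space_distr space_borel)
        have m: "measure P S = prob (X k -` S \<inter> space M)" if "S \<in> sets borel" for S
          unfolding distr[OF k, symmetric] using that k by (intro measure_distr) auto
        have "prob (X k -` B k \<inter> space M) = measure P (\<Inter>i. (\<lambda>u. u $ i) -` A (k, i) \<inter> space P)"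
          unfolding m[OF B[OF k], symmetric] by (auto simp: B_def sP intro!: arg_cong[of _ _ "measure P"])
        also have "\<dots> = (\<Prod>i\<in>UNIV. measure P ((\<lambda>u. u $ i) -` A (k, i) \<inter> space P))"
          using A[OF k] by (intro prob_space.indep_varsD_finite[OF P indep]) auto
        also have "\<dots> = (\<Prod>i\<in>UNIV. prob (Y (k, i) -` A (k, i) \<inter> space M))"
        proof (intro prod.cong refl)
          fix i
          have "(\<lambda>u :: real ^ 'd. u $ i) -` A (k, i) \<inter> space borel \<in> sets borel"
            by (rule measurable_sets[OF proj A[OF k]])
          then show "measure P ((\<lambda>u. u $ i) -` A (k, i) \<inter> space P) = prob (Y (k, i) -` A (k, i) \<inter> space M)"
            by (simp add: sP m Y_def vimage_def)
        qed
        finally show ?thesis .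
      qed
      have "(\<Inter>j\<in>{1..N} \<times> UNIV. Y j -` A j \<inter> space M) = (\<Inter>k\<in>{1..N}. X k -` B k \<inter> space M)"
        using N by (auto simp: Y_def B_def)
      then have "prob (\<Inter>j\<in>{1..N} \<times> UNIV. Y j -` A j \<inter> space M) = (\<Prod>k\<in>{1..N}. prob (X k -` B k \<inter> space M))"
        by (simp only:) (rule indep_varsD_finite[OF X], use N B in auto)
      also have "\<dots> = (\<Prod>k\<in>{1..N}. \<Prod>i\<in>UNIV. prob (Y (k, i) -` A (k, i) \<inter> space M))"
        by (intro prod.cong PB refl)
      also have "\<dots> = (\<Prod>j\<in>{1..N} \<times> UNIV. prob (Y j -` A j \<inter> space M))"
        unfolding prod.cartesian_product by (intro prod.cong) auto
      finally show "prob (\<Inter>j\<in>{1..N} \<times> UNIV. Y j -` A j \<inter> space M) =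
        (\<Prod>j\<in>{1..N} \<times> UNIV. prob (Y j -` A j \<inter> space M))" .
    qed
  qed (use N comp_meas in \<open>auto simp: Y_def Int_stable_def sets.sigma_sets_eq[of borel, simplified]\<close>)
qed

lemma indep_vars_coordinate_samples:
  fixes X :: "nat \<Rightarrow> 'a \<Rightarrow> real ^ 'd::finite"
  assumes N: "1 \<le> N" and P: "prob_space P"
    and indep: "prob_space.indep_vars P (\<lambda>_. borel) (\<lambda>i u. u $ i) UNIV"
    and X: "indep_vars (\<lambda>_. borel) X {1..N}"
    and distr: "\<And>j. j \<in> {1..N} \<Longrightarrow> distr M borel (X j) = P"
  shows "indep_vars (\<lambda>_. Pi\<^sub>M {1..N} (\<lambda>_. borel)) (\<lambda>i \<omega>. \<lambda>k\<in>{1..N}. X k \<omega> $ i) (UNIV :: 'd set)"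
proof -
  define Y where "Y = (\<lambda>(k, i) \<omega>. X k \<omega> $ i)"
  have "indep_vars (\<lambda>i. Pi\<^sub>M ({1..N} \<times> {i}) (\<lambda>_. borel))
      (\<lambda>i \<omega>. restrict (\<lambda>j. Y j \<omega>) ({1..N} \<times> {i})) (UNIV :: 'd set)"
    unfolding Y_def
    by (rule indep_vars_restrict[OF indep_vars_sample_components[OF assms]])
       (auto simp: disjoint_family_on_def)
  then have "indep_vars (\<lambda>_. Pi\<^sub>M {1..N} (\<lambda>_. borel))
      (\<lambda>i \<omega>. (\<lambda>z. \<lambda>k\<in>{1..N}. z (k, i)) (restrict (\<lambda>j. Y j \<omega>) ({1..N} \<times> {i}))) UNIV"
    by (rule indep_vars_compose2) (intro measurable_restrict measurable_component_singleton, simp)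
  then show ?thesis
    by (rule indep_vars_cong[THEN iffD1, rotated -1]) (auto simp: Y_def fun_eq_iff)
qed

lemma distr_coordinate_sample:
  fixes X :: "nat \<Rightarrow> 'a \<Rightarrow> real ^ 'd::finite"
  assumes N: "1 \<le> N"
    and X: "indep_vars (\<lambda>_. borel) X {1..N}"
    and distr: "\<And>j. j \<in> {1..N} \<Longrightarrow> distr M borel (X j) = P"
  shows "distr M (Pi\<^sub>M {1..N} (\<lambda>_. borel)) (\<lambda>\<omega>. \<lambda>k\<in>{1..N}. X k \<omega> $ i) =
    Pi\<^sub>M {1..N} (\<lambda>_. distr P borel (\<lambda>u. u $ i))"
proof -
  have X_meas [measurable]: "X k \<in> borel_measurable M" if "k \<in> {1..N}" for k
    using X that by (auto simp: indep_vars_def)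
  have ind: "indep_vars (\<lambda>_. borel) (\<lambda>k \<omega>. X k \<omega> $ i) {1..N}"
    by (rule indep_vars_compose2[OF X]) measurable
  then have rv: "random_variable borel (\<lambda>\<omega>. X k \<omega> $ i)" if "k \<in> {1..N}" for k
    using that by (simp add: indep_vars_def)
  have "distr M (Pi\<^sub>M {1..N} (\<lambda>_. borel)) (\<lambda>\<omega>. \<lambda>k\<in>{1..N}. X k \<omega> $ i) =
      Pi\<^sub>M {1..N} (\<lambda>k. distr M borel (\<lambda>\<omega>. X k \<omega> $ i))"
    by (rule indep_vars_iff_distr_eq_PiM'[THEN iffD1, OF _ rv ind]) (use N in auto)
  also have "\<dots> = Pi\<^sub>M {1..N} (\<lambda>_. distr P borel (\<lambda>u. u $ i))"
  proof (intro PiM_cong refl)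
    fix k assume k: "k \<in> {1..N}"
    show "distr M borel (\<lambda>\<omega>. X k \<omega> $ i) = distr P borel (\<lambda>u. u $ i)"
      unfolding distr[OF k, symmetric] using k by (subst distr_distr) (auto simp: comp_def)
  qed
  finally show ?thesis .
qed

lemma prob_all_ks_accept:
  fixes X :: "nat \<Rightarrow> 'a \<Rightarrow> real ^ 'd::finite"
  assumes \<alpha>: "\<alpha> \<le> 1" and N: "1 \<le> N" and P: "prob_space P" "sets P = sets borel"
    and indep: "prob_space.indep_vars P (\<lambda>_. borel) (\<lambda>i u. u $ i) UNIV"
    and X: "indep_vars (\<lambda>_. borel) X {1..N}"
    and distr: "\<And>j. j \<in> {1..N} \<Longrightarrow> distr M borel (X j) = P"
    and ks: "ks_threshold N (1 - root CARD('d) (1 - \<alpha>)) \<Gamma>"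
  defines "A \<equiv> {\<omega> \<in> space M. \<forall>i. ks_stat N (distr P borel (\<lambda>u. u $ i)) (\<lambda>k. X k \<omega> $ i) \<le> \<Gamma>}"
  shows "A \<in> events" "1 - \<alpha> \<le> prob A"
proof -
  define Q where "Q i = distr P borel (\<lambda>u. u $ i)" for i
  have [measurable_cong]: "sets P = sets borel" by fact
  have Q: "prob_space (Q i)" "sets (Q i) = sets borel" for i
    unfolding Q_def by (auto intro!: prob_space.prob_space_distr P)
  define Z where "Z i \<omega> = (\<lambda>k\<in>{1..N}. X k \<omega> $ i)" for i \<omega>
  define S where "S i = {x \<in> space (Pi\<^sub>M {1..N} (\<lambda>_. borel)). ks_stat N (Q i) x \<le> \<Gamma>}" for i
  have S: "S i \<in> sets (Pi\<^sub>M {1..N} (\<lambda>_. borel))" for i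
    unfolding S_def by (rule ks_accept_measurable[OF N Q])
  have Z: "indep_vars (\<lambda>_. Pi\<^sub>M {1..N} (\<lambda>_. borel)) Z UNIV"
    unfolding Z_def by (rule indep_vars_coordinate_samples[OF N P(1) indep X distr])
  then have Z_meas: "Z i \<in> M \<rightarrow>\<^sub>M Pi\<^sub>M {1..N} (\<lambda>_. borel)" for i
    by (auto simp: indep_vars_def)
  have A_eq: "A = (\<Inter>i. Z i -` S i \<inter> space M)"
  proof -
    have "ks_stat N (Q i) (Z i \<omega>) = ks_stat N (Q i) (\<lambda>k. X k \<omega> $ i)" for i \<omega>
      by (rule ks_stat_cong) (simp add: Z_def)
    moreover have "Z i \<omega> \<in> space (Pi\<^sub>M {1..N} (\<lambda>_. borel))" if "\<omega> \<in> space M" for i \<omega>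
      by (rule measurable_space[OF Z_meas that])
    ultimately show ?thesis
      unfolding A_def S_def Q_def[symmetric] by auto
  qed
  show "A \<in> events"
    unfolding A_eq using S Z_meas by (intro sets.finite_INT measurable_sets) auto
  have S_prob: "root CARD('d) (1 - \<alpha>) \<le> prob (Z i -` S i \<inter> space M)" for i
  proof -
    have "root CARD('d) (1 - \<alpha>) \<le> measure (Pi\<^sub>M {1..N} (\<lambda>_. Q i)) (S i)"
      using ks_accept_prob[OF N Q ks, of i] by (simp add: S_def)
    also have "Pi\<^sub>M {1..N} (\<lambda>_. Q i) = distr M (Pi\<^sub>M {1..N} (\<lambda>_. borel)) (Z i)"
      unfolding Z_def Q_def by (rule distr_coordinate_sample[OF N X distr, symmetric])
    also have "measure \<dots> (S i) = prob (Z i -` S i \<inter> space M)"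
      by (rule measure_distr[OF Z_meas S])
    finally show ?thesis .
  qed
  have "1 - \<alpha> = (\<Prod>i\<in>(UNIV :: 'd set). root CARD('d) (1 - \<alpha>))"
    using \<alpha> by simp
  also have "\<dots> \<le> (\<Prod>i\<in>UNIV. prob (Z i -` S i \<inter> space M))"
    using \<alpha> S_prob by (intro prod_mono) auto
  also have "\<dots> = prob A"
    unfolding A_eq by (rule indep_varsD_finite[OF Z _ _ S, symmetric]) simp_all
  finally show "1 - \<alpha> \<le> prob A" .
qed

end

section \<open>Guarantee and support function of the uncertainty set\<close>

theorem theorem5:
  fixes P :: "(real ^ 'd::finite) measure"
    and M :: "'w measure"
    and X :: "nat \<Rightarrow> 'w \<Rightarrow> real ^ 'd"
    and lo hi :: "real ^ 'd"
    and N :: nat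
    and \<alpha> \<Gamma> :: real
    and h :: "'w \<Rightarrow> 'd \<Rightarrow> nat \<Rightarrow> real"
  assumes alpha: "0 < \<alpha>" "\<alpha> < 1"
    and N: "1 \<le> N"
    and P: "prob_space P" "sets P = sets borel"
    and indep_components: "prob_space.indep_vars P (\<lambda>_. borel) (\<lambda>i u. u $ i) UNIV"
    and supp: "measure_support P \<subseteq> {u. \<forall>i. lo $ i \<le> u $ i \<and> u $ i \<le> hi $ i}"
    and M: "prob_space M"
    and iid: "prob_space.indep_vars M (\<lambda>_. borel) X {1..N}"
      "\<And>j. j \<in> {1..N} \<Longrightarrow> distr M borel (X j) = P"
    and ks: "ks_threshold N (1 - root CARD('d) (1 - \<alpha>)) \<Gamma>"
    and h_def: "\<And>\<omega> i j. h \<omega> i j = ext_order_stat N (lo $ i) (hi $ i) (\<lambda>k. X k \<omega> $ i) j"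
  shows "(\<exists>A\<in>sets M. measure M A \<ge> 1 - \<alpha> \<and>
            (\<forall>\<omega>\<in>A. simultaneously_implies_guarantee TYPE('k::finite) P (U_indep N \<Gamma> (h \<omega>))))
       \<and> (\<forall>\<omega>\<in>space M. \<forall>\<epsilon> v. 0 < \<epsilon> \<and> \<epsilon> < 1 \<longrightarrow>
            support_fun v (U_indep N \<Gamma> (h \<omega>) \<epsilon>)
              = (INF \<mu>\<in>{0..}. ereal (dual_objective N \<Gamma> (h \<omega>) \<epsilon> v \<mu>)))"
proof -
  interpret prob_space M by fact
  have [measurable_cong]: "sets P = sets borel" by fact
  have \<Gamma>: "0 \<le> \<Gamma>" "\<Gamma> \<le> 1" using ks by (auto simp: ks_threshold_def)
  note N\<Gamma> = N \<Gamma>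
  have X_meas [measurable]: "X k \<in> borel_measurable M" if "k \<in> {1..N}" for k
    using iid(1) that by (auto simp: indep_vars_def)
  define Q where "Q i = distr P borel (\<lambda>u. u $ i)" for i
  have Q: "prob_space (Q i)" "sets (Q i) = sets borel" for i
    unfolding Q_def by (auto intro!: prob_space.prob_space_distr P)
  have box: "AE u in P. \<forall>i. lo $ i \<le> u $ i \<and> u $ i \<le> hi $ i"
    using AE_in_superset_of_support[OF P supp] by simp
  have box_Q: "AE u in Q i. lo $ i \<le> u \<and> u \<le> hi $ i" for i
    unfolding Q_def using box by (subst AE_distr_iff) auto
  \<comment> \<open>Almost surely the samples lie in the box as well, which orders the extended order statistics.\<close>
  define A where "A = {\<omega> \<in> space M. \<forall>i. ks_stat N (Q i) (\<lambda>k. X k \<omega> $ i) \<le> \<Gamma>}"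
  define B where "B = {\<omega> \<in> space M. \<forall>k\<in>{1..N}. \<forall>i. lo $ i \<le> X k \<omega> $ i \<and> X k \<omega> $ i \<le> hi $ i}"
  have A: "A \<in> events" "1 - \<alpha> \<le> prob A"
    unfolding A_def Q_def
    using prob_all_ks_accept[OF _ N P indep_components iid ks] alpha by auto
  have B: "B \<in> events"
    unfolding B_def by (intro sets.sets_Collect_finite_All sets.sets_Collect_finite_All) auto
  have "AE \<omega> in M. \<forall>k\<in>{1..N}. \<forall>i. lo $ i \<le> X k \<omega> $ i \<and> X k \<omega> $ i \<le> hi $ i"
  proof (intro AE_finite_allI)
    fix k assume k: "k \<in> {1..N}"
    have "AE u in distr M borel (X k). \<forall>i. lo $ i \<le> u $ i \<and> u $ i \<le> hi $ i"
      unfolding iid(2)[OF k] by (rule box)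
    then show "AE \<omega> in M. \<forall>i. lo $ i \<le> X k \<omega> $ i \<and> X k \<omega> $ i \<le> hi $ i"
      by (rule AE_distrD[OF X_meas[OF k]])
  qed simp
  then have "prob (A \<inter> B) = prob A"
    using A(1) B by (intro finite_measure_eq_AE) (auto simp: B_def elim: AE_mp)
  moreover have "simultaneously_implies_guarantee TYPE('k) P (U_indep N \<Gamma> (h \<omega>))"
    if "\<omega> \<in> A \<inter> B" for \<omega>
  proof (rule U_indep_implies_guarantee[OF P indep_components _ N\<Gamma>])
    fix i
    have "h \<omega> i = ext_order_stat N (lo $ i) (hi $ i) (\<lambda>k. X k \<omega> $ i)"
      by (rule ext) (rule h_def)
    then show "mgf_dominated N \<Gamma> (h \<omega> i) (distr P borel (\<lambda>u. u $ i))"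
      unfolding Q_def[symmetric] using that
      by (auto simp: A_def B_def intro!: mgf_dominated_if_ks_accepts N\<Gamma> Q box_Q)
  qed
  ultimately have "\<exists>A\<in>sets M. measure M A \<ge> 1 - \<alpha> \<and>
      (\<forall>\<omega>\<in>A. simultaneously_implies_guarantee TYPE('k) P (U_indep N \<Gamma> (h \<omega>)))"
    using A B by (intro bexI[of _ "A \<inter> B"]) auto
  then show ?thesis
    using support_fun_U_indep[OF N\<Gamma>] by blast
qed

end
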